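(* Let $\mathcal{H}=(C,F,D,G)$ be a hybrid system on $\mathbb{R}^n$ satisfying the Basic Assumptions, and let $\Gamma_1\subset\Gamma_2\subset\mathbb{R}^n$ with $\Gamma_1$ compact and $\Gamma_2$ closed. Assume that (i) $\Gamma_1$ is globally asymptotically stable relative to $\Gamma_2$, and (ii) $\Gamma_2$ is globally attractive for $\mathcal{H}$. Then the basin of attraction of $\Gamma_1$ (for $\mathcal{H}$) is the set $$\mathcal{B}:=\{x_0\in\mathbb{R}^n:\text{ all }x\in\mathcal{S}_{\mathcal{H}}(x_0)\text{ are bounded}\}.$$ In particular, if $\mathcal{B}$ contains $\Gamma_1$ in its interior, then $\Gamma_1$ is attractive for $\mathcal{H}$; and if all solutions of $\mathcal{H}$ are bounded, then $\Gamma_1$ is globally attractive for $\mathcal{H}$.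
   Context: Notation: $|x|_\Gamma=\inf_{y\in\Gamma}|x-y|$ and, for $c>0$, $B_c(\Gamma)=\{x\in\mathbb{R}^n:|x|_\Gamma<c\}$. Hybrid system: a 4-tuple $\mathcal{H}=(C,F,D,G)$ satisfying the Basic Assumptions: (A1) $C,D$ are closed subsets of $\mathbb{R}^n$; (A2) $F:\mathbb{R}^n\rightrightarrows\mathbb{R}^n$ is a set-valued map that is outer semicontinuous, locally bounded on $C$, with $F(x)$ nonempty and convex for each $x\in C$; (A3) $G:\mathbb{R}^n\rightrightarrows\mathbb{R}^n$ is outer semicontinuous, locally bounded on $D$, with $G(x)$ nonempty for each $x\in D$. Solutions: a hybrid time domain is a subset of $\mathbb{R}_{\ge0}\times\mathbb{N}$ that is a union of infinitely many sets $[t_j,t_{j+1}]\times\{j\}$, $j\in\mathbb{N}$, or of finitely many such sets with the last one of the form $[t_j,t_{j+1}]\times\{j\}$, $[t_j,t_{j+1})\times\{j\}$ or $[t_j,\infty)\times\{j\}$, where $0=t_0\le t_1\le\cdots$. A hybrid arc is a function $x:\mathrm{dom}(x)\to\mathbb{R}^n$ on a hybrid time domain such that for each $j$ the map $t\mapsto x(t,j)$ is locally absolutely continuous on $I_j=\{t:(t,j)\in\mathrm{dom}(x)\}$. A solution of $\mathcal{H}$ is a hybrid arc such that: for each $j$ for which $I_j$ has nonempty interior, $\dot x(t,j)\in F(x(t,j))$ for almost all $t\in I_j$ and $x(t,j)\in C$ for all $t\in[\min I_j,\sup I_j)$; and whenever $(t,j),(t,j+1)\in\mathrm{dom}(x)$,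 $x(t,j)\in D$ and $x(t,j+1)\in G(x(t,j))$. (From a point outside $C\cup D$ the only solution is the trivial one with domain $\{(0,0)\}$.) All solutions considered are maximal (cannot be extended). A solution is complete if its domain is unbounded, and bounded if its range is bounded. $\mathcal{S}_{\mathcal{H}}(x_0)$ is the set of maximal solutions with $x(0,0)=x_0$, $\mathcal{S}_{\mathcal{H}}(U)=\bigcup_{x_0\in U}\mathcal{S}_{\mathcal{H}}(x_0)$, and $\mathrm{rge}(\mathcal{S}_{\mathcal{H}}(U))$ is the union of the ranges of the solutions in $\mathcal{S}_{\mathcal{H}}(U)$. Compact $\Gamma$: $\Gamma$ is stable for $\mathcal{H}$ if for every $\varepsilon>0$ there is $\delta>0$ with $\mathrm{rge}(\mathcal{S}_{\mathcal{H}}(B_\delta(\Gamma)))\subset B_\varepsilon(\Gamma)$. The basin of attraction of $\Gamma$ is the set of points $p\in\mathbb{R}^n$ such that each $x\in\mathcal{S}_{\mathcal{H}}(p)$ is bounded and, if $x$ is complete, $|x(t,j)|_\Gamma\to0$ as $t+j\to\infty$, $(t,j)\in\mathrm{dom}(x)$. Closed $\Gamma$: the basin of attraction of $\Gamma$ is the set of $p\in\mathbb{R}^n$ such that for each $x\in\mathcal{S}_{\mathcal{H}}(p)$, $|x|_\Gamma$ is bounded and, if $x$ is complete, $|x(t,j)|_\Gamma\to0$ as $t+j\to\infty$. In both cases, $\Gamma$ is attractive if its basin of attraction contains $\Gamma$ in its interior; globally attractive if its basin of attraction is $\mathbb{R}^n$; globally asymptotically stable if stable and globally attractive. Relative properties: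 for a closed set $\Gamma_2$, the restriction of $\mathcal{H}$ to $\Gamma_2$ is $\mathcal{H}|_{\Gamma_2}=(C\cap\Gamma_2,F,D\cap\Gamma_2,G)$. $\Gamma_1\subset\Gamma_2$ has a property relative to $\Gamma_2$ if it has that property for $\mathcal{H}|_{\Gamma_2}$. *)

theory Defs
  imports "HOL-Analysis.Analysis"
begin

section \<open>Hybrid systems\<close>

record 'a hybrid_system =
  flow_set :: "'a set"
  flow_map :: "'a \<Rightarrow> 'a set"
  jump_set :: "'a set"
  jump_map :: "'a \<Rightarrow> 'a set"

definition outer_semicontinuous_on :: "'a::metric_space set \<Rightarrow> ('a \<Rightarrow> 'b::metric_space set) \<Rightarrow> bool" where
  "outer_semicontinuous_on S M \<longleftrightarrow>
     (\<forall>x\<in>S. \<forall>u v y. (\<forall>i. u i \<in> S \<and> v i \<in> M (u i)) \<and> u \<longlonglongrightarrow> x \<and> v \<longlonglongrightarrow> y \<longrightarrow> y \<in> M x)"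

definition locally_bounded_on :: "'a::metric_space set \<Rightarrow> ('a \<Rightarrow> 'b::metric_space set) \<Rightarrow> bool" where
  "locally_bounded_on S M \<longleftrightarrow>
     (\<forall>x\<in>S. \<exists>U. open U \<and> x \<in> U \<and> bounded (\<Union>y\<in>U \<inter> S. M y))"

text \<open>Outer semicontinuity and local boundedness are required only relative to the flow set and
  the jump set, respectively, since the data outside these sets play no role for solutions.\<close>

definition basic_assumptions :: "'a::euclidean_space hybrid_system \<Rightarrow> bool" where
  "basic_assumptions H \<longleftrightarrow>
     closed (flow_set H) \<and> closed (jump_set H) \<and>
     outer_semicontinuous_on (flow_set H) (flow_map H) \<and>
     locally_bounded_on (flow_set H) (flow_map H) \<and>
     (\<forall>x\<in>flow_set H. flow_map H x \<noteq> {} \<and> convex (flow_map H x)) \<and>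
     outer_semicontinuous_on (jump_set H) (jump_map H) \<and>
     locally_bounded_on (jump_set H) (jump_map H) \<and>
     (\<forall>x\<in>jump_set H. jump_map H x \<noteq> {})"

definition restriction :: "'a hybrid_system \<Rightarrow> 'a set \<Rightarrow> 'a hybrid_system" where
  "restriction H \<Gamma> =
     \<lparr>flow_set = flow_set H \<inter> \<Gamma>, flow_map = flow_map H,
      jump_set = jump_set H \<inter> \<Gamma>, jump_map = jump_map H\<rparr>"

section \<open>Solutions\<close>

text \<open>In the finite case the last piece is the one with index \<open>J\<close>. A half-open last piece is
  required to be nonempty; this only excludes the empty set from the time domains.\<close>

definition hybrid_time_domain :: "(real \<times> nat) set \<Rightarrow> bool" where
  "hybrid_time_domain E \<longleftrightarrow>
     (\<exists>t :: nat \<Rightarrow> real. t 0 = 0 \<and> (\<forall>j. t j \<le> t (Suc j)) \<and>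
        (E = (\<Union>j. {t j..t (Suc j)} \<times> {j}) \<or>
         (\<exists>J L. E = (\<Union>j<J. {t j..t (Suc j)} \<times> {j}) \<union> L \<times> {J} \<and>
            (L = {t J..t (Suc J)} \<or>
             t J < t (Suc J) \<and> L = {t J..<t (Suc J)} \<or>
             L = {t J..}))))"

definition time_slice :: "(real \<times> nat) set \<Rightarrow> nat \<Rightarrow> real set" where
  "time_slice E j = {t. (t, j) \<in> E}"

definition absolutely_continuous_on :: "real set \<Rightarrow> (real \<Rightarrow> 'a::real_normed_vector) \<Rightarrow> bool" where
  "absolutely_continuous_on I f \<longleftrightarrow>
     (\<forall>\<epsilon>>0. \<exists>\<delta>>0. \<forall>d S. S \<subseteq> I \<and> d division_of S \<and> (\<Sum>K\<in>d. measure lborel K) < \<delta> \<longrightarrow>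
        (\<Sum>K\<in>d. norm (f (Sup K) - f (Inf K))) < \<epsilon>)"

definition locally_absolutely_continuous_on ::
  "real set \<Rightarrow> (real \<Rightarrow> 'a::real_normed_vector) \<Rightarrow> bool" where
  "locally_absolutely_continuous_on I f \<longleftrightarrow>
     (\<forall>a b. {a..b} \<subseteq> I \<longrightarrow> absolutely_continuous_on {a..b} f)"

text \<open>An arc is a pair of a time domain \<open>E\<close> and a total function \<open>x\<close>, of which only the values
  on \<open>E\<close> matter.\<close>

type_synonym 'a arc = "(real \<times> nat) set \<times> (real \<Rightarrow> nat \<Rightarrow> 'a)"

definition hybrid_arc :: "'a::real_normed_vector arc \<Rightarrow> bool" where
  "hybrid_arc = (\<lambda>(E, x). hybrid_time_domain E \<and>
     (\<forall>j. locally_absolutely_continuous_on (time_slice E j) (\<lambda>t. x t j)))"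

text \<open>For an interval \<open>I\<close> with a minimum, the set of \<open>t \<in> I\<close> such that \<open>t < s\<close> for some \<open>s \<in> I\<close>
  is \<open>[min I, sup I)\<close>, also when \<open>I\<close> is unbounded.\<close>

definition solution :: "'a::euclidean_space hybrid_system \<Rightarrow> 'a arc \<Rightarrow> bool" where
  "solution H = (\<lambda>(E, x). hybrid_arc (E, x) \<and>
     (\<forall>j. interior (time_slice E j) \<noteq> {} \<longrightarrow>
        (AE t in lebesgue. t \<in> time_slice E j \<longrightarrow>
           (\<exists>v\<in>flow_map H (x t j).
              ((\<lambda>s. x s j) has_vector_derivative v) (at t within time_slice E j))) \<and>
        (\<forall>t\<in>time_slice E j. (\<exists>s\<in>time_slice E j. t < s) \<longrightarrow> x t j \<in> flow_set H)) \<and>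
     (\<forall>t j. (t, j) \<in> E \<and> (t, Suc j) \<in> E \<longrightarrow>
        x t j \<in> jump_set H \<and> x t (Suc j) \<in> jump_map H (x t j)))"

definition maximal_solution :: "'a::euclidean_space hybrid_system \<Rightarrow> 'a arc \<Rightarrow> bool" where
  "maximal_solution H = (\<lambda>(E, x). solution H (E, x) \<and>
     \<not> (\<exists>E' x'. solution H (E', x') \<and> E \<subset> E' \<and> (\<forall>(t, j)\<in>E. x' t j = x t j)))"

definition solutions_from :: "'a::euclidean_space hybrid_system \<Rightarrow> 'a set \<Rightarrow> 'a arc set" where
  "solutions_from H U = {(E, x). maximal_solution H (E, x) \<and> x 0 0 \<in> U}"

definition arc_range :: "'a arc \<Rightarrow> 'a set" where
  "arc_range = (\<lambda>(E, x). (\<lambda>(t, j). x t j) ` E)"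

definition reach :: "'a::euclidean_space hybrid_system \<Rightarrow> 'a set \<Rightarrow> 'a set" where
  "reach H U = (\<Union>\<phi>\<in>solutions_from H U. arc_range \<phi>)"

definition complete_arc :: "'a arc \<Rightarrow> bool" where
  "complete_arc = (\<lambda>(E, x). \<not> bounded ((\<lambda>(t, j). (t, real j)) ` E))"

definition bounded_arc :: "'a::metric_space arc \<Rightarrow> bool" where
  "bounded_arc \<phi> \<longleftrightarrow> bounded (arc_range \<phi>)"

definition converges_to :: "'a::metric_space arc \<Rightarrow> 'a set \<Rightarrow> bool" where
  "converges_to = (\<lambda>(E, x) \<Gamma>.
     ((\<lambda>(t, j). infdist (x t j) \<Gamma>) \<longlongrightarrow> 0)
       (inf (filtercomap (\<lambda>(t, j). t + real j) at_top) (principal E)))"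

section \<open>Stability and attractivity\<close>

definition nbhd :: "real \<Rightarrow> 'a::metric_space set \<Rightarrow> 'a set" where
  "nbhd c \<Gamma> = {x. infdist x \<Gamma> < c}"

definition stable :: "'a::euclidean_space hybrid_system \<Rightarrow> 'a set \<Rightarrow> bool" where
  "stable H \<Gamma> \<longleftrightarrow> (\<forall>\<epsilon>>0. \<exists>\<delta>>0. reach H (nbhd \<delta> \<Gamma>) \<subseteq> nbhd \<epsilon> \<Gamma>)"

text \<open>The unmarked notions are those for compact \<open>\<Gamma>\<close>; the variants for closed \<open>\<Gamma>\<close> ask only that
  the distance of a solution to \<open>\<Gamma>\<close> be bounded.\<close>

definition basin :: "'a::euclidean_space hybrid_system \<Rightarrow> 'a set \<Rightarrow> 'a set" where
  "basin H \<Gamma> = {p. \<forall>\<phi>\<in>solutions_from H {p}.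
     bounded_arc \<phi> \<and> (complete_arc \<phi> \<longrightarrow> converges_to \<phi> \<Gamma>)}"

definition basin_closed :: "'a::euclidean_space hybrid_system \<Rightarrow> 'a set \<Rightarrow> 'a set" where
  "basin_closed H \<Gamma> = {p. \<forall>\<phi>\<in>solutions_from H {p}.
     bounded ((\<lambda>y. infdist y \<Gamma>) ` arc_range \<phi>) \<and> (complete_arc \<phi> \<longrightarrow> converges_to \<phi> \<Gamma>)}"

definition attractive :: "'a::euclidean_space hybrid_system \<Rightarrow> 'a set \<Rightarrow> bool" where
  "attractive H \<Gamma> \<longleftrightarrow> \<Gamma> \<subseteq> interior (basin H \<Gamma>)"

definition globally_attractive :: "'a::euclidean_space hybrid_system \<Rightarrow> 'a set \<Rightarrow> bool" where
  "globally_attractive H \<Gamma> \<longleftrightarrow> basin H \<Gamma> = UNIV"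

definition globally_attractive_closed :: "'a::euclidean_space hybrid_system \<Rightarrow> 'a set \<Rightarrow> bool" where
  "globally_attractive_closed H \<Gamma> \<longleftrightarrow> basin_closed H \<Gamma> = UNIV"

definition globally_asymptotically_stable :: "'a::euclidean_space hybrid_system \<Rightarrow> 'a set \<Rightarrow> bool" where
  "globally_asymptotically_stable H \<Gamma> \<longleftrightarrow> stable H \<Gamma> \<and> globally_attractive H \<Gamma>"

definition bounded_solution_points :: "'a::euclidean_space hybrid_system \<Rightarrow> 'a set" where
  "bounded_solution_points H = {p. \<forall>\<phi>\<in>solutions_from H {p}. bounded_arc \<phi>}"

end

theory Submission
  imports Defs "HOL-Complex_Analysis.Great_Picard" "HOL-Library.Diagonal_Subsequence"
begin

text \<open>A complete hybrid time domain is given by its nondecreasing sequence of extended real jump times,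
  so uniformly bounded complete solutions are compact: along a subsequence the jump times converge in
  the extended reals, and the pieces between jumps, equi-Lipschitz by the local boundedness of the
  flow map, converge pointwise. The flow condition passes to the limit in the integrated form
  ``if \<open>a \<bullet> v \<le> b\<close> for all velocities \<open>v\<close> available on \<open>[s, t]\<close>, then \<open>a \<bullet> (x t - x s) \<le> b (t - s)\<close>'',
  from which the differential inclusion is recovered by separating hyperplanes at the points of
  differentiability of the Lipschitz limit.

  Let \<open>x\<close> be a bounded complete solution; it converges to \<open>\<Gamma>2\<close>, so limits of its time shifts are complete
  solutions in \<open>\<Gamma>2\<close> and hence converge to \<open>\<Gamma>1\<close>. Thus \<open>x\<close> comes close to \<open>\<Gamma>1\<close> again and again. If \<open>x\<close> did not
  converge to \<open>\<Gamma>1\<close>, shift it to (nearly) the last times at which it is close to \<open>\<Gamma>1\<close> before it is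
  \<open>\<epsilon>\<close>-far. The limit comes close to \<open>\<Gamma>1\<close> again, so the lengths of these excursions are bounded, and the
  limit is itself \<open>\<epsilon>\<close>-far at some time, contradicting stability relative to \<open>\<Gamma>2\<close>.\<close>

section \<open>Absolutely continuous and Lipschitz functions of a real variable\<close>

text \<open>The obstacle is that compactness controls shifted arcs on bounded hybrid times only: the
  \<epsilon>-far ends of the excursions could run off to infinity, and the limit would then say
  nothing about them. The return of the limit to \<Gamma>1, which is attractivity relative to
  \<Gamma>2, is what rules this out. Both relative properties are silent about a solution that stays
  outside \<Gamma>2, so they are only ever applied to limits. The real analysis serves the passage
  between the differential inclusion and its integrated form. One way is a mean value inequality for
  absolutely continuous functions whose derivative is bounded almost everywhere, applied to the
  scalar functions \<open>a \<bullet> x\<close>. The way back needs a Lipschitz limit to be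
  differentiable almost everywhere, which is derived from Vitali's covering theorem; convexity of
  the velocity sets enters there, through the separation of a point from a closed convex
  set.\<close>

lemma lmeasurable_outer_open:
  assumes "S \<in> lmeasurable" "measure lebesgue S < m"
  obtains T where "open T" "S \<subseteq> T" "T \<in> lmeasurable" "measure lebesgue T < m"
proof -
  define e where "e = m - measure lebesgue S"
  have "e > 0" using assms by (simp add: e_def)
  with assms obtain T where T: "open T" "S \<subseteq> T" "(T - S) \<in> lmeasurable" "emeasure lebesgue (T - S) < ennreal e"
    using sets_lebesgue_outer_open[of S e] by (auto simp: fmeasurable_def)
  have eq: "T = S \<union> (T - S)" using T by auto
  have "T \<in> lmeasurable" using fmeasurable.Un[OF assms(1) T(3)] eq by simp
  moreover have "measure lebesgue (T - S) < e"
    using T(3,4) \<open>e > 0\<close> by (simp add: emeasure_eq_measure2 ennreal_less_iff)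
  moreover have "measure lebesgue T \<le> measure lebesgue S + measure lebesgue (T - S)"
    using measure_Un_le[of S lebesgue "T - S"] assms(1) T(3) eq by auto
  ultimately show ?thesis using that T e_def by auto
qed

text \<open>In a tagged division fine for a suitable gauge, the intervals with tags outside \<open>N\<close> are controlled by the
  derivative; the others have small total length, so absolute continuity applies to them.\<close>

lemma increment_le_of_derivative_ae_le:
  fixes f :: "real \<Rightarrow> real"
  assumes ac: "absolutely_continuous_on {a..b} f" and ab: "a \<le> b"
    and N: "negligible N"
    and der: "\<And>r. r \<in> {a..b} - N \<Longrightarrow> \<exists>v\<le>c. (f has_vector_derivative v) (at r within {a..b})"
  shows "f b - f a \<le> c * (b - a)"
proof (rule field_le_epsilon)
  fix e0 :: real assume "e0 > 0"
  \<comment> \<open>Error budget: \<open>e * (b - a)\<close> for the derivative on the good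
    intervals, one \<open>e\<close> for the increments over the bad ones by absolute continuity, and
    one \<open>e\<close> for \<open>\<bar>c\<bar>\<close> times the length of the bad ones. The two
    bounds on the measure of \<open>U\<close> below serve the last two items.\<close>
  define e where "e = e0 / (2 + (b - a))"
  have e: "e > 0" "e * (b - a) + 2 * e = e0"
  proof -
    have D: "2 + (b - a) > 0" using ab by simp
    then show "e > 0" using \<open>e0 > 0\<close> unfolding e_def by simp
    have "e * (2 + (b - a)) = e0" unfolding e_def using D by simp
    then show "e * (b - a) + 2 * e = e0" by (simp add: algebra_simps)
  qed
  obtain \<delta> where \<delta>: "\<delta> > 0" and AC: "\<And>d S. S \<subseteq> {a..b} \<Longrightarrow> d division_of S \<Longrightarrow>
      (\<Sum>K\<in>d. measure lborel K) < \<delta> \<Longrightarrow> (\<Sum>K\<in>d. norm (f (Sup K) - f (Inf K))) < e"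
    using ac e(1) unfolding absolutely_continuous_on_def by meson
  have "N \<in> lmeasurable" "measure lebesgue N = 0"
    using N negligible_iff_measure by auto
  moreover have "min \<delta> (e / (\<bar>c\<bar> + 1)) > 0" using \<delta> e(1) by simp
  ultimately obtain U where U: "open U" "N \<subseteq> U" "U \<in> lmeasurable"
      "measure lebesgue U < min \<delta> (e / (\<bar>c\<bar> + 1))"
    using lmeasurable_outer_open[of N "min \<delta> (e / (\<bar>c\<bar> + 1))"] by auto
  define Q where "Q x r \<longleftrightarrow> r > 0 \<and> (x \<in> N \<longrightarrow> ball x r \<subseteq> U)
     \<and> (x \<in> {a..b} - N \<longrightarrow> (\<forall>u v. u \<le> x \<and> x \<le> v \<and> a \<le> u \<and> v \<le> b \<and> {u..v} \<subseteq> ball x r \<longrightarrow>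
        f v - f u \<le> (c + e) * (v - u)))" for x r
  have "\<exists>r. Q x r" for x
    proof (cases "x \<in> N")
      case True
      then obtain r where "r > 0" "ball x r \<subseteq> U" using U open_contains_ball by blast
      then show ?thesis using True by (auto simp: Q_def)
    next
      case False
      show ?thesis
      proof (cases "x \<in> {a..b}")
        case True
        then obtain v where v: "v \<le> c" "(f has_vector_derivative v) (at x within {a..b})"
          using der False by blast
        then have "(f has_derivative (\<lambda>h. h * v)) (at x within {a..b})"
          by (simp add: has_vector_derivative_def)
        then obtain r where r: "r > 0" "\<And>y. y \<in> {a..b} \<Longrightarrow> \<bar>y - x\<bar> < r \<Longrightarrow>
            \<bar>f y - f x - (y - x) * v\<bar> \<le> e * \<bar>y - x\<bar>"
          using e(1) unfolding has_derivative_within_alt by (metis real_norm_def)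
        \<comment> \<open>Straddling: as \<open>x\<close> lies between \<open>u\<close> and
          \<open>t\<close>, the errors at the two ends add up to exactly
          \<open>e * (t - u)\<close>.\<close>
        have "f t - f u \<le> (c + e) * (t - u)"
          if "u \<le> x" "x \<le> t" "a \<le> u" "t \<le> b" "{u..t} \<subseteq> ball x r" for u t
        proof -
          have "u \<in> {u..t}" "t \<in> {u..t}" using that by auto
          then have "u \<in> ball x r" "t \<in> ball x r" using that(5) by blast+
          then have "\<bar>u - x\<bar> < r" "\<bar>t - x\<bar> < r" by (auto simp: dist_real_def)
          then have "\<bar>f t - f x - (t - x) * v\<bar> \<le> e * \<bar>t - x\<bar>" "\<bar>f u - f x - (u - x) * v\<bar> \<le> e * \<bar>u - x\<bar>"
            using r(2)[of t] r(2)[of u] that(1-4) by auto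
          then have "f t - f u \<le> (v + e) * (t - u)" using that(1-4) by (auto simp: algebra_simps)
          also have "\<dots> \<le> (c + e) * (t - u)" using v that by (intro mult_right_mono) auto
          finally show ?thesis .
        qed
        then have "Q x r" using r(1) False by (simp add: Q_def)
        then show ?thesis by blast
      next
        case False
        then show ?thesis using \<open>x \<notin> N\<close> by (intro exI[of _ 1]) (auto simp: Q_def)
      qed
    qed
  then obtain g where "\<And>x. Q x (g x)" by metis
  then have gg: "g x > 0 \<and> (x \<in> N \<longrightarrow> ball x (g x) \<subseteq> U)
     \<and> (x \<in> {a..b} - N \<longrightarrow> (\<forall>u v. u \<le> x \<and> x \<le> v \<and> a \<le> u \<and> v \<le> b \<and> {u..v} \<subseteq> ball x (g x) \<longrightarrow>
        f v - f u \<le> (c + e) * (v - u)))" for x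
    by (simp add: Q_def)
  have g: "gauge (\<lambda>x. ball x (g x))" using gg by (simp add: gauge_def)
  have gU: "ball x (g x) \<subseteq> U" if "x \<in> N" for x using gg[of x] that by simp
  have gd: "f v - f u \<le> (c + e) * (v - u)"
    if "x \<in> {a..b} - N" "u \<le> x" "x \<le> v" "a \<le> u" "v \<le> b" "{u..v} \<subseteq> ball x (g x)" for x u v
    using gg[of x] that by simp
  obtain p where p: "p tagged_division_of {a..b}" "(\<lambda>x. ball x (g x)) fine p"
    using fine_division_exists[OF g, of a b] by auto
  note pD = tagged_division_ofD[OF p(1)]
  have iv: "\<exists>u v. K = {u..v} \<and> u \<le> x \<and> x \<le> v \<and> a \<le> u \<and> v \<le> b \<and> x \<in> {a..b} \<and> {u..v} \<subseteq> ball x (g x)"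
    if xK: "(x, K) \<in> p" for x K
  proof -
    obtain u v where K: "K = {u..v}" using pD(4)[OF xK] by auto
    have "x \<in> {u..v}" "{u..v} \<subseteq> {a..b}" "{u..v} \<subseteq> ball x (g x)"
      using pD(2,3)[OF xK] fineD[OF p(2) xK] K by auto
    then show ?thesis using K by (intro exI[of _ u] exI[of _ v]) auto
  qed
  define q where "q = {xk \<in> p. fst xk \<in> N}"
  define w where "w = (\<lambda>(x::real, K). f (Sup K) - f (Inf K))"
  define l where "l = (\<lambda>(x::real, K::real set). measure lborel K)"
  have qp: "q \<subseteq> p" and fp: "finite p" using pD(1) by (auto simp: q_def)
  then have fq: "finite q" using finite_subset by auto
  have sumw: "sum w p = f b - f a"
    using additive_tagged_division_1[OF ab p(1), of f] by (simp add: w_def)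
  have suml: "sum l p = b - a"
  proof -
    have "sum (\<lambda>(x,K). measure lborel K) p = measure lborel {a..b}"
      using additive_content_tagged_division[of p a b] p(1) by simp
    moreover have "sum l p = sum (\<lambda>(x,K). measure lborel K) p"
    proof (rule sum.cong)
      fix y assume "y \<in> p"
      then obtain x K where y: "y = (x, K)" "(x, K) \<in> p" by (cases y) auto
      then show "l y = (case y of (x, K) \<Rightarrow> measure lborel K)" using iv[OF y(2)] by (auto simp: l_def)
    qed simp
    ultimately show ?thesis using ab by simp
  qed
  have lnn: "l y \<ge> 0" for y by (auto simp: l_def split: prod.split)
  have td: "q tagged_division_of \<Union>(snd ` q)"
    using p(1) qp by (metis tagged_division_of_def tagged_partial_division_of_Union_self
        tagged_partial_division_subset)
  have dv: "snd ` q division_of \<Union>(snd ` q)" by (rule division_of_tagged_division[OF td])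
  have sub: "\<Union>(snd ` q) \<subseteq> {a..b}" using pD(3) qp by fastforce
  have subU: "\<Union>(snd ` q) \<subseteq> U"
  proof (rule Union_least)
    fix K assume "K \<in> snd ` q"
    then obtain x where x: "(x, K) \<in> p" "x \<in> N" by (auto simp: q_def)
    then show "K \<subseteq> U" using iv[OF x(1)] gU[OF x(2)] by blast
  qed
  have lq: "sum l q = (\<Sum>K\<in>snd ` q. measure lborel K)"
    unfolding l_def
    by (rule sum.over_tagged_division_lemma[OF td]) auto
  have "(\<Sum>K\<in>snd ` q. measure lborel K) = (\<Sum>K\<in>snd ` q. measure lebesgue K)"
  proof (rule sum.cong)
    fix K assume "K \<in> snd ` q"
    then obtain x where x: "(x, K) \<in> p" by (auto simp: q_def)
    show "measure lborel K = measure lebesgue K" using iv[OF x] by auto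
  qed simp
  also have "\<dots> = measure lebesgue (\<Union>(snd ` q))"
    using content_division[OF dv] by simp
  also have "\<dots> \<le> measure lebesgue U"
    by (rule measure_mono_fmeasurable[OF subU fmeasurableD[OF lmeasurable_division[OF dv]] U(3)])
  finally have mq: "(\<Sum>K\<in>snd ` q. measure lborel K) \<le> measure lebesgue U" .
  then have small: "(\<Sum>K\<in>snd ` q. norm (f (Sup K) - f (Inf K))) < e"
    using AC[OF sub dv] U(4) by linarith
  have "(\<bar>c\<bar> + 1) * sum l q \<le> e"
  proof -
    have "(\<bar>c\<bar> + 1) * sum l q \<le> (\<bar>c\<bar> + 1) * measure lebesgue U"
      using mq unfolding lq by (intro mult_left_mono) auto
    also have "\<dots> \<le> e" using U(4) by (simp add: field_simps)
    finally show ?thesis .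
  qed
  moreover have "\<bar>c\<bar> * sum l q \<le> (\<bar>c\<bar> + 1) * sum l q"
    using sum_nonneg[of q l] lnn by (intro mult_right_mono) auto
  ultimately have cq: "\<bar>c\<bar> * sum l q \<le> e" by linarith
  \<comment> \<open>The transfer from tagged pairs to intervals asks for the value 0 on every
    degenerate box, also on the empty one, where \<open>Sup\<close> and \<open>Inf\<close> carry no
    information.\<close>
  define d where "d K = (if K = {} then 0 else f (Sup K) - f (Inf K))" for K
  have ne: "K \<noteq> {}" if xK: "(x, K) \<in> q" for x K using pD(2)[of x K] qp xK by auto
  have "sum w q = sum (\<lambda>(x, K). d K) q"
    unfolding w_def by (rule sum.cong) (use ne in \<open>auto simp: d_def\<close>)
  also have "\<dots> = sum d (snd ` q)"
  proof (rule sum.over_tagged_division_lemma[OF td])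
    fix u v :: real
    assume "box u v = {}"
    then have "u \<ge> v" by (simp add: box_real)
    then show "d (cbox u v) = 0" by (cases "u = v") (auto simp: d_def)
  qed
  also have "\<dots> = (\<Sum>K\<in>snd ` q. f (Sup K) - f (Inf K))"
    by (rule sum.cong) (use ne in \<open>auto simp: d_def\<close>)
  also have "\<dots> \<le> (\<Sum>K\<in>snd ` q. norm (f (Sup K) - f (Inf K)))" by (intro sum_mono) auto
  finally have wq: "sum w q \<le> e" using small by simp
  have "w y \<le> (c + e) * l y" if yp: "y \<in> p - q" for y
  proof -
    obtain x K where y: "y = (x, K)" by (cases y)
    then obtain u v where "K = {u..v}" "u \<le> x" "x \<le> v" "a \<le> u" "v \<le> b" "x \<in> {a..b} - N"
        "{u..v} \<subseteq> ball x (g x)"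
      using iv[of x K] yp by (auto simp: q_def)
    then show ?thesis using gd[of x u v] y by (simp add: w_def l_def)
  qed
  then have "sum w (p - q) \<le> (c + e) * sum l (p - q)"
    unfolding sum_distrib_left by (rule sum_mono)
  also have "sum l (p - q) = b - a - sum l q"
    using sum_diff[OF fp qp, of l] suml by simp
  finally have "sum w (p - q) \<le> (c + e) * (b - a - sum l q)" .
  moreover have "sum w p = sum w q + sum w (p - q)"
    using sum.subset_diff[OF qp fp, of w] by simp
  moreover have "sum l q \<ge> 0" using lnn by (simp add: sum_nonneg)
  then have "- c * sum l q \<le> \<bar>c\<bar> * sum l q" "e * sum l q \<ge> 0"
    using e(1) mult_right_mono[of "- c" "\<bar>c\<bar>" "sum l q"] by auto
  ultimately show "f b - f a \<le> c * (b - a) + e0"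
    using sumw wq cq e(2) by (simp add: algebra_simps)
qed

section \<open>Differentiability almost everywhere of Lipschitz functions\<close>

text \<open>Intervals around \<open>x\<close>, with \<open>x\<close> allowed as an endpoint, treat
  left and right derivates at once. With \<open>s < p\<close> the lower derivate over such intervals
  is at most \<open>p\<close>; with \<open>s > q\<close> the upper one is at least
  \<open>q\<close>.\<close>

definition has_fine_slopes :: "(real \<Rightarrow> real) \<Rightarrow> (real \<Rightarrow> bool) \<Rightarrow> real \<Rightarrow> bool" where
  "has_fine_slopes f P x \<longleftrightarrow>
     (\<forall>d>0. \<exists>u v. u \<le> x \<and> x \<le> v \<and> u < v \<and> v - u < d \<and> P ((f v - f u) / (v - u)))"

text \<open>The intervals witnessing \<open>has_fine_slopes\<close> form a Vitali cover. They can be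
  taken arbitrarily short, so asking them to lie in the open \<open>U\<close> loses no point of
  \<open>S \<inter> U\<close>.\<close>

lemma fine_slopes_Vitali_cover:
  assumes S: "\<And>x. x \<in> S \<Longrightarrow> has_fine_slopes f P x" and U: "open U"
  obtains C where "countable C" "pairwise disjnt C" "\<Union>C \<subseteq> U" "negligible (S \<inter> U - \<Union>C)"
    "\<forall>I\<in>C. \<exists>u v. u < v \<and> I = {u..v} \<and> P ((f v - f u) / (v - u))"
proof -
  \<comment> \<open>Centre and radius, as the covering theorem speaks of balls; the point to be
    covered need not be the centre.\<close>
  define K where "K = {(a::real, r). r > 0 \<and> cball a r \<subseteq> U \<and>
      P ((f (a + r) - f (a - r)) / (2 * r))}"
  have "\<exists>i. i \<in> K \<and> x \<in> cball (fst i) (snd i) \<and> snd i < d" if x: "x \<in> S \<inter> U" and d: "0 < d" for x d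
  proof -
    obtain e where e: "e > 0" "ball x e \<subseteq> U" using U x open_contains_ball by blast
    obtain u v where uv: "u \<le> x" "x \<le> v" "u < v" "v - u < min d e" "P ((f v - f u) / (v - u))"
      using S[of x] x d e(1) unfolding has_fine_slopes_def by (meson IntD1 min_less_iff_conj)
    define a r where "a = (u + v) / 2" and "r = (v - u) / 2"
    have ar: "a + r = v" "a - r = u" "2 * r = v - u" by (auto simp: a_def r_def field_simps)
    then have cb: "cball a r = {u..v}" by (simp add: cball_eq_atLeastAtMost)
    have "{u..v} \<subseteq> ball x e" using uv by (auto simp: dist_real_def)
    then have "(a, r) \<in> K" using uv e ar cb by (auto simp: K_def)
    moreover have "r < d" "x \<in> cball a r" using uv cb by (auto simp: r_def)
    ultimately show ?thesis by (intro exI[of _ "(a, r)"]) simp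
  qed
  then have cover: "\<And>x d. x \<in> S \<inter> U \<Longrightarrow> 0 < d \<Longrightarrow> \<exists>i. i \<in> K \<and> x \<in> cball (fst i) (snd i) \<and> snd i < d"
    by blast
  have pos: "\<And>i. i \<in> K \<Longrightarrow> 0 < snd i" by (auto simp: K_def)
  obtain C where C: "countable C" "C \<subseteq> K"
     "pairwise (\<lambda>i j. disjnt (cball (fst i) (snd i)) (cball (fst j) (snd j))) C"
     "negligible (S \<inter> U - (\<Union>i \<in> C. cball (fst i) (snd i)))"
    by (rule Vitali_covering_theorem_cballs[OF pos cover])
  show ?thesis
  proof (rule that[of "(\<lambda>i. cball (fst i) (snd i)) ` C"])
    show "pairwise disjnt ((\<lambda>i. cball (fst i) (snd i)) ` C)"
      using C(3) by (auto simp: pairwise_def)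
    show "\<forall>I\<in>(\<lambda>i. cball (fst i) (snd i)) ` C. \<exists>u v. u < v \<and> I = {u..v} \<and> P ((f v - f u) / (v - u))"
    proof
      fix I assume I: "I \<in> (\<lambda>i. cball (fst i) (snd i)) ` C"
      obtain a r where ar: "(a, r) \<in> K" "I = cball a r" using C(2) I by fastforce
      then show "\<exists>u v. u < v \<and> I = {u..v} \<and> P ((f v - f u) / (v - u))"
        by (intro exI[of _ "a - r"] exI[of _ "a + r"]) (auto simp: K_def cball_eq_atLeastAtMost)
    qed
    show "\<Union> ((\<lambda>i. cball (fst i) (snd i)) ` C) \<subseteq> U"
      using C(2) by (fastforce simp: K_def)
  qed (use C(1,4) in simp_all)
qed

lemma emeasure_disjoint_Union_le:
  fixes M N :: "real measure"
  assumes C: "countable C" "pairwise disjnt C" and sets: "sets M = sets borel" "sets N = sets borel"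
    and cl: "\<And>I. I \<in> C \<Longrightarrow> closed I"
    and le: "\<And>I. I \<in> C \<Longrightarrow> c * emeasure M I \<le> d * emeasure N I"
  shows "c * emeasure M (\<Union>C) \<le> d * emeasure N (\<Union>C)"
proof -
  have dj: "disjoint_family_on (\<lambda>x. x) C"
    using C(2) by (auto simp: pairwise_def disjoint_family_on_def disjnt_def)
  have eq: "c * emeasure Q (\<Union>C) = (\<integral>\<^sup>+I. c * emeasure Q I \<partial>count_space C)" if "sets Q = sets borel" for Q :: "real measure" and c
    using emeasure_UN_countable[of C "\<lambda>x. x" Q] C(1) dj cl that
    by (subst nn_integral_cmult) auto
  show ?thesis
    unfolding eq[OF sets(1)] eq[OF sets(2)] by (intro nn_integral_mono) (use le in auto)
qed

text \<open>\<open>S\<close> is not known to be measurable, so the argument runs with its outer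
  measure \<open>m\<close>, finite because \<open>S\<close> is bounded: \<open>step\<close> would
  push a positive \<open>m\<close> below itself. The set returned by \<open>step\<close> need not be
  open, hence the appeal to outer regularity before it is compared with \<open>m\<close>.\<close>

lemma negligible_of_outer_contraction:
  fixes S :: "real set"
  assumes S: "bounded S" and \<theta>: "0 < \<theta>" "\<theta> < 1"
    and step: "\<And>U. open U \<Longrightarrow> S \<subseteq> U \<Longrightarrow> U \<in> lmeasurable \<Longrightarrow>
      \<exists>V. S \<subseteq> V \<and> V \<in> lmeasurable \<and> measure lebesgue V \<le> \<theta> * measure lebesgue U"
  shows "negligible S"
proof -
  define A where "A = {measure lebesgue U |U. open U \<and> S \<subseteq> U \<and> U \<in> lmeasurable}"
  define m where "m = Inf A"
  obtain a e where "S \<subseteq> ball a e" using S bounded_subset_ballD by blast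
  then have ne: "A \<noteq> {}" unfolding A_def by (auto intro!: exI[of _ "ball a e"])
  have bb: "bdd_below A" unfolding A_def by (auto intro!: bdd_belowI[of _ 0])
  have m0: "m \<ge> 0" unfolding m_def by (rule cInf_greatest[OF ne]) (auto simp: A_def)
  have "m = 0"
  proof (rule ccontr)
    assume "m \<noteq> 0"
    then have "m < m / \<theta>" using m0 \<theta> by (simp add: field_simps)
    then obtain U where U: "open U" "S \<subseteq> U" "U \<in> lmeasurable" "measure lebesgue U < m / \<theta>"
      using cInf_lessD[OF ne, of "m / \<theta>"] by (auto simp: m_def A_def)
    obtain V where V: "S \<subseteq> V" "V \<in> lmeasurable" "measure lebesgue V \<le> \<theta> * measure lebesgue U"
      using step U by blast
    have "\<theta> * measure lebesgue U < m" using U(4) \<theta> by (simp add: field_simps)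
    then obtain W where W: "open W" "V \<subseteq> W" "W \<in> lmeasurable" "measure lebesgue W < m"
      using lmeasurable_outer_open[OF V(2), of m] V(3) by auto
    then have "measure lebesgue W \<in> A" using V(1) unfolding A_def by blast
    then show False using cInf_lower[OF _ bb] W(4) unfolding m_def by force
  qed
  show ?thesis
    unfolding negligible_outer
  proof (intro allI impI)
    fix e :: real assume "e > 0"
    then obtain x where "x \<in> A" "x < e" using cInf_lessD[OF ne, of e] \<open>m = 0\<close> by (auto simp: m_def)
    then show "\<exists>T. S \<subseteq> T \<and> T \<in> lmeasurable \<and> measure lebesgue T < e" by (auto simp: A_def)
  qed
qed

text \<open>Vitali's covering theorem, used first for intervals of slope less than \<open>p\<close> and then, inside these,
  for intervals of slope greater than \<open>q\<close>, covers \<open>S\<close> up to a null set by a set of measure at most \<open>p / q\<close>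
  times that of any open superset.\<close>

lemma negligible_Dini_gap:
  fixes g :: "real \<Rightarrow> real"
  assumes mono: "\<And>x y. x \<le> y \<Longrightarrow> g x \<le> g y" and cont: "continuous_on UNIV g"
    and pq: "0 < p" "p < q" and bdd: "bounded S"
    and S: "\<And>x. x \<in> S \<Longrightarrow> has_fine_slopes g (\<lambda>s. s < p) x \<and> has_fine_slopes g (\<lambda>s. s > q) x"
  shows "negligible S"
proof (rule negligible_of_outer_contraction[OF bdd, of "p / q"])
  fix U assume U: "open U" "S \<subseteq> U" "U \<in> lmeasurable"
  \<comment> \<open>The Stieltjes measure of \<open>g\<close> makes the slope bounds additive over
    disjoint intervals: \<open>q\<close> times the length of \<open>\<Union>D\<close> is at most its
    \<mu>-measure, hence at most that of \<open>\<Union>C\<close>, hence at most \<open>p\<close>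
    times the length of \<open>\<Union>C\<close>.\<close>
  define \<mu> where "\<mu> = interval_measure g"
  have sets\<mu>: "sets \<mu> = sets borel" by (simp add: \<mu>_def)
  have \<mu>: "emeasure \<mu> {u..v} = ennreal (g v - g u)" if "u \<le> v" for u v
    unfolding \<mu>_def using emeasure_interval_measure_Icc[OF that mono cont] by simp
  obtain C where C: "countable C" "pairwise disjnt C" "\<Union>C \<subseteq> U" "negligible (S \<inter> U - \<Union>C)"
    "\<forall>I\<in>C. \<exists>u v. u < v \<and> I = {u..v} \<and> (g v - g u) / (v - u) < p"
    by (rule fine_slopes_Vitali_cover[OF conjunct1[OF S] U(1)])
  \<comment> \<open>The second cover must be taken inside an open set; passing to interiors loses
    only countably many endpoints.\<close>
  define O1 where "O1 = (\<Union>I\<in>C. interior I)"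
  have "open O1" by (auto simp: O1_def)
  obtain D where D: "countable D" "pairwise disjnt D" "\<Union>D \<subseteq> O1" "negligible (S \<inter> O1 - \<Union>D)"
    "\<forall>I\<in>D. \<exists>u v. u < v \<and> I = {u..v} \<and> (g v - g u) / (v - u) > q"
    by (rule fine_slopes_Vitali_cover[OF conjunct2[OF S] \<open>open O1\<close>])
  have clC: "closed I" if "I \<in> C" for I using C(5) that by auto
  have clD: "closed I" if "I \<in> D" for I using D(5) that by auto
  have bC: "\<Union>C \<in> sets borel" and bD: "\<Union>D \<in> sets borel"
    by (intro sets.countable_Union C(1) D(1) subsetI borel_closed clC clD; assumption)+
  have "ennreal q * emeasure lborel (\<Union>D) \<le> 1 * emeasure \<mu> (\<Union>D)"
  proof (rule emeasure_disjoint_Union_le[OF D(1,2)])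
    show "sets lborel = sets borel" "sets \<mu> = sets borel" using sets\<mu> by simp_all
    show "closed I" if "I \<in> D" for I using clD that .
    fix I assume "I \<in> D"
    then obtain u v where I: "u < v" "I = {u..v}" "(g v - g u) / (v - u) > q" using D(5) by blast
    then have "q * (v - u) \<le> g v - g u" by (simp add: field_simps)
    then have "ennreal (q * (v - u)) \<le> emeasure \<mu> I"
      using I(1,2) \<mu>[of u v] by (simp add: ennreal_leI)
    moreover have "ennreal (q * (v - u)) = ennreal q * emeasure lborel I"
      using I(1,2) pq ennreal_mult[of q "v - u"] by simp
    ultimately show "ennreal q * emeasure lborel I \<le> 1 * emeasure \<mu> I" by (simp only: mult_1)
  qed
  also have "\<dots> \<le> 1 * emeasure \<mu> (\<Union>C)"
  proof -
    have "O1 \<subseteq> \<Union>C" unfolding O1_def using interior_subset by blast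
    then show ?thesis using D(3) bC sets\<mu> by (auto intro!: emeasure_mono)
  qed
  also have "\<dots> \<le> ennreal p * emeasure lborel (\<Union>C)"
  proof (rule emeasure_disjoint_Union_le[OF C(1,2)])
    show "sets lborel = sets borel" "sets \<mu> = sets borel" using sets\<mu> by simp_all
    show "closed I" if "I \<in> C" for I using clC that .
    fix I assume "I \<in> C"
    then obtain u v where I: "u < v" "I = {u..v}" "(g v - g u) / (v - u) < p" using C(5) by blast
    then have "g v - g u \<le> p * (v - u)" by (simp add: field_simps)
    then have "emeasure \<mu> I \<le> ennreal (p * (v - u))"
      using I(1,2) \<mu>[of u v] by (simp add: ennreal_leI)
    moreover have "ennreal (p * (v - u)) = ennreal p * emeasure lborel I"
      using I(1,2) pq ennreal_mult[of p "v - u"] by simp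
    ultimately show "1 * emeasure \<mu> I \<le> ennreal p * emeasure lborel I" by (simp only: mult_1)
  qed
  also have "\<dots> \<le> ennreal p * emeasure lebesgue U"
  proof -
    have "emeasure lborel (\<Union>C) = emeasure lebesgue (\<Union>C)" using bC by simp
    also have "\<dots> \<le> emeasure lebesgue U" using C(3) U(3) by (intro emeasure_mono) auto
    finally show ?thesis by (intro mult_left_mono) auto
  qed
  finally have *: "ennreal q * emeasure lborel (\<Union>D) \<le> ennreal p * emeasure lebesgue U" .
  have "\<Union>D \<subseteq> U" using D(3) C(3) interior_subset unfolding O1_def by blast
  then have mD: "\<Union>D \<in> lmeasurable"
    using U(3) bD by (intro fmeasurableI2[OF U(3)]) auto
  have "emeasure lborel (\<Union>D) = ennreal (measure lebesgue (\<Union>D))"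
  proof -
    have "emeasure lborel (\<Union>D) = emeasure lebesgue (\<Union>D)" using bD by simp
    then show ?thesis using emeasure_eq_measure2[OF mD] by (rule trans)
  qed
  with * have "ennreal (q * measure lebesgue (\<Union>D)) \<le> ennreal (p * measure lebesgue U)"
    using U(3) pq by (simp add: emeasure_eq_measure2 ennreal_mult)
  then have le: "measure lebesgue (\<Union>D) \<le> p / q * measure lebesgue U"
    using pq by (simp add: ennreal_le_iff field_simps)
  have "negligible (\<Union>C - O1)"
  proof (rule negligible_subset)
    have "countable (\<Union>I\<in>C. I - interior I)"
    proof (rule countable_UN[OF C(1)])
      fix I assume "I \<in> C"
      then obtain u v where I: "I = {u..v}" using C(5) by blast
      have "{u..v} - {u<..<v} \<subseteq> {u, v}" by auto
      then have "countable ({u..v} - {u<..<v})" by (rule countable_subset) simp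
      then show "countable (I - interior I)" by (simp add: I interior_atLeastAtMost_real)
    qed
    then show "negligible (\<Union>I\<in>C. I - interior I)"
      by (simp only: negligible_iff_null_sets null_sets_completionI countable_imp_null_set_lborel)
    show "\<Union>C - O1 \<subseteq> (\<Union>I\<in>C. I - interior I)" unfolding O1_def by blast
  qed
  then have "negligible ((S \<inter> U - \<Union>C) \<union> (S \<inter> O1 - \<Union>D) \<union> (\<Union>C - O1))"
    by (rule negligible_Un[OF negligible_Un[OF C(4) D(4)]])
  then have neg: "negligible (S - \<Union>D)"
    by (rule negligible_subset) (use U(2) in blast)
  show "\<exists>V. S \<subseteq> V \<and> V \<in> lmeasurable \<and> measure lebesgue V \<le> p / q * measure lebesgue U"
  proof (intro exI conjI)
    have n: "S - \<Union>D \<in> lmeasurable" "measure lebesgue (S - \<Union>D) = 0"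
      using neg negligible_iff_measure by auto
    show "S \<subseteq> \<Union>D \<union> (S - \<Union>D)" by auto
    show "\<Union>D \<union> (S - \<Union>D) \<in> lmeasurable" using mD n(1) by (rule fmeasurable.Un)
    show "measure lebesgue (\<Union>D \<union> (S - \<Union>D)) \<le> p / q * measure lebesgue U"
      using measure_Un_le[of "\<Union>D" lebesgue "S - \<Union>D"] mD n le by auto
  qed
qed (use pq in auto)

text \<open>Adding \<open>(L + 1) * x\<close> moves all slopes into the interval from 1 to
  \<open>2 * L + 1\<close>, which gives the monotonicity and the positive slopes that
  \<open>negligible_Dini_gap\<close> asks for. Where the quotients fail to converge, two rationals
  fit between the lower and the upper derivate, so countably many null sets suffice; the balls make
  each of them bounded.\<close>

lemma lipschitz_real_differentiable_ae:
  fixes f :: "real \<Rightarrow> real"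
  assumes lip: "\<And>x y. \<bar>f x - f y\<bar> \<le> L * \<bar>x - y\<bar>"
  obtains N where "negligible N" "\<And>x. x \<notin> N \<Longrightarrow> f differentiable at x"
proof -
  define g where "g x = f x + (L + 1) * x" for x
  have L0: "L \<ge> 0" using lip[of 1 0] by (simp add: order_trans[OF abs_ge_zero])
  have slope: "1 \<le> (g v - g u) / (v - u)" "(g v - g u) / (v - u) \<le> 2 * L + 1" if "u < v" for u v
    using lip[of v u] that by (auto simp: g_def field_simps abs_le_iff)
  have mono: "g x \<le> g y" if "x \<le> y" for x y
    using slope(1)[of x y] that by (cases "x = y") (auto simp: field_simps)
  have "L-lipschitz_on UNIV f"
    using lip L0 by (auto simp: lipschitz_on_def dist_real_def)
  then have cont: "continuous_on UNIV g"
    unfolding g_def by (intro continuous_intros lipschitz_on_continuous_on)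
  define T where "T p q = {x. has_fine_slopes g (\<lambda>s. s < p) x \<and> has_fine_slopes g (\<lambda>s. s > q) x}" for p q
  define N where "N = (\<Union>(p, q, n)\<in>{(p, q, n::nat). p \<in> \<rat> \<and> q \<in> \<rat> \<and> 0 < p \<and> p < q}. T p q \<inter> ball 0 (real n))"
  show ?thesis
  proof (rule that[of N])
    have "countable {(p, q, n::nat). p \<in> \<rat> \<and> q \<in> \<rat> \<and> 0 < p \<and> p < (q::real)}"
      by (rule countable_subset[of _ "\<rat> \<times> \<rat> \<times> UNIV"]) (auto simp: countable_rat)
    then show "negligible N"
      unfolding N_def
    proof (rule negligible_countable_Union[OF countable_image])
      fix S assume "S \<in> (\<lambda>(p, q, n). T p q \<inter> ball 0 (real n)) ` {(p, q, n::nat). p \<in> \<rat> \<and> q \<in> \<rat> \<and> 0 < p \<and> p < q}"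
      then obtain p q n where pq: "0 < p" "p < q" and S: "S = T p q \<inter> ball 0 (real n)" by auto
      show "negligible S"
      proof (rule negligible_Dini_gap[OF mono cont pq])
        show "bounded S" unfolding S by (rule bounded_Int) simp
        show "\<And>x. x \<in> S \<Longrightarrow> has_fine_slopes g (\<lambda>s. s < p) x \<and> has_fine_slopes g (\<lambda>s. s > q) x"
          unfolding S T_def by blast
      qed
    qed
    fix x assume x: "x \<notin> N"
    \<comment> \<open>The lower bounds valid for all sufficiently short intervals around
      \<open>x\<close>; thus \<open>m\<close> is the lower derivate, the candidate for the
      derivative of \<open>g\<close>.\<close>
    define A where "A = {r. \<exists>d>0. \<forall>u v. u \<le> x \<and> x \<le> v \<and> u < v \<and> v - u < d \<longrightarrow> r \<le> (g v - g u) / (v - u)}"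
    define m where "m = Sup A"
    have A1: "1 \<in> A" unfolding A_def using slope(1) by (auto intro!: exI[of _ 1])
    have Ab: "bdd_above A"
    proof (rule bdd_aboveI)
      fix r assume "r \<in> A"
      then obtain d where "d > 0" "\<And>u v. u \<le> x \<Longrightarrow> x \<le> v \<Longrightarrow> u < v \<Longrightarrow> v - u < d \<Longrightarrow> r \<le> (g v - g u) / (v - u)"
        unfolding A_def by blast
      from this(2)[of x "x + d/2"] slope(2)[of x "x + d/2"] \<open>d > 0\<close> show "r \<le> 2 * L + 1" by auto
    qed
    have m1: "m \<ge> 1" unfolding m_def using A1 Ab by (rule cSup_upper)
    have der: "((\<lambda>y. (g y - g x) / (y - x)) \<longlongrightarrow> m) (at x)"
    proof (rule LIM_I)
      fix e :: real assume e: "e > 0"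
      obtain r where r: "r \<in> A" "m - e < r" using less_cSupD[of A "m - e"] A1 e unfolding m_def by auto
      then obtain d1 where d1: "d1 > 0"
        "\<And>u v. u \<le> x \<Longrightarrow> x \<le> v \<Longrightarrow> u < v \<Longrightarrow> v - u < d1 \<Longrightarrow> r \<le> (g v - g u) / (v - u)"
        unfolding A_def by blast
      \<comment> \<open>Two rationals just above \<open>m\<close>: slopes below \<open>p\<close>
        occur at every scale because \<open>p \<notin> A\<close>, so outside \<open>N\<close> slopes
        above \<open>q\<close> cannot.\<close>
      obtain p where p: "p \<in> \<rat>" "m < p" "p < m + e" using Rats_dense_in_real[of m "m + e"] e by auto
      obtain q where q: "q \<in> \<rat>" "p < q" "q < m + e" using Rats_dense_in_real[of p "m + e"] p by auto
      have "p \<notin> A" using cSup_upper[of p A] Ab p(2) unfolding m_def by force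
      then have "has_fine_slopes g (\<lambda>s. s < p) x"
        unfolding A_def has_fine_slopes_def by (auto simp: not_le)
      moreover obtain n where "x \<in> ball 0 (real n)" using reals_Archimedean2[of "\<bar>x\<bar>"] by auto
      ultimately have "\<not> has_fine_slopes g (\<lambda>s. s > q) x"
        using x p q m1 by (auto simp: N_def T_def)
      then obtain d2 where d2: "d2 > 0"
        "\<And>u v. u \<le> x \<Longrightarrow> x \<le> v \<Longrightarrow> u < v \<Longrightarrow> v - u < d2 \<Longrightarrow> (g v - g u) / (v - u) \<le> q"
        unfolding has_fine_slopes_def not_all not_imp not_ex by (meson not_le)
      show "\<exists>s>0. \<forall>y. y \<noteq> x \<and> norm (y - x) < s \<longrightarrow> norm ((g y - g x) / (y - x) - m) < e"
      proof (intro exI[of _ "min d1 d2"] conjI allI impI)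
        fix y assume y: "y \<noteq> x \<and> norm (y - x) < min d1 d2"
        have "r \<le> (g y - g x) / (y - x) \<and> (g y - g x) / (y - x) \<le> q"
        proof (cases "x < y")
          case True
          then show ?thesis using d1(2)[of x y] d2(2)[of x y] y by auto
        next
          case False
          have "(g y - g x) / (y - x) = (g x - g y) / (x - y)"
            by (metis minus_diff_eq minus_divide_divide)
          then show ?thesis using d1(2)[of y x] d2(2)[of y x] y False by auto
        qed
        then show "norm ((g y - g x) / (y - x) - m) < e" using r(2) q(3) by auto
      qed (use d1 d2 in auto)
    qed
    then have "(g has_field_derivative m) (at x)" by (simp add: has_field_derivative_iff)
    then have "((\<lambda>x. g x - (L + 1) * x) has_field_derivative m - (L + 1)) (at x)"
      by (auto intro!: derivative_eq_intros)
    then show "f differentiable at x"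
      unfolding g_def using field_differentiable_def field_differentiable_imp_differentiable by fastforce
  qed
qed

lemma lipschitz_differentiable_ae:
  fixes f :: "real \<Rightarrow> 'a::euclidean_space"
  assumes lip: "\<And>x y. norm (f x - f y) \<le> L * \<bar>x - y\<bar>"
  obtains N where "negligible N" "\<And>x. x \<notin> N \<Longrightarrow> f differentiable at x"
proof -
  have "\<exists>N. negligible N \<and> (\<forall>x. x \<notin> N \<longrightarrow> (\<lambda>x. f x \<bullet> i) differentiable at x)" if "i \<in> Basis" for i
  proof -
    have "\<bar>f x \<bullet> i - f y \<bullet> i\<bar> \<le> L * \<bar>x - y\<bar>" for x y
      using Basis_le_norm[OF that, of "f x - f y"] lip[of x y] by (simp add: inner_diff_left)
    then show ?thesis using lipschitz_real_differentiable_ae[of "\<lambda>x. f x \<bullet> i" L] by metis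
  qed
  then obtain N where N: "\<And>i. i \<in> Basis \<Longrightarrow> negligible (N i)"
      "\<And>i x. i \<in> Basis \<Longrightarrow> x \<notin> N i \<Longrightarrow> (\<lambda>x. f x \<bullet> i) differentiable at x" by metis
  show ?thesis
  proof (rule that[of "\<Union>i\<in>Basis. N i"])
    show "negligible (\<Union>i\<in>Basis. N i)" using N(1) by (intro negligible_Union) auto
    show "f differentiable at x" if "x \<notin> (\<Union>i\<in>Basis. N i)" for x
      using N(2) that by (subst differentiable_componentwise_within) auto
  qed
qed

section \<open>Complete hybrid time domains\<close>

definition jump_times :: "(nat \<Rightarrow> ereal) \<Rightarrow> bool" where
  "jump_times T \<longleftrightarrow> T 0 = 0 \<and> mono T"

text \<open>Infinite jump times encode finitely many jumps followed by a flow for all times; the slices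
  after an infinite jump time are empty.\<close>

definition jump_domain :: "(nat \<Rightarrow> ereal) \<Rightarrow> (real \<times> nat) set" where
  "jump_domain T = {(t, j). T j \<le> ereal t \<and> ereal t \<le> T (Suc j)}"

lemma mem_jump_domain [simp]: "(t, j) \<in> jump_domain T \<longleftrightarrow> T j \<le> ereal t \<and> ereal t \<le> T (Suc j)"
  by (simp add: jump_domain_def)

lemma time_slice_jump_domain: "time_slice (jump_domain T) j = {t. T j \<le> ereal t \<and> ereal t \<le> T (Suc j)}"
  by (simp add: time_slice_def)

lemma jump_times_nonneg: "jump_times T \<Longrightarrow> 0 \<le> T j"
  unfolding jump_times_def by (metis le0 monoD)

lemma jump_times_mono: "jump_times T \<Longrightarrow> i \<le> j \<Longrightarrow> T i \<le> T j"
  unfolding jump_times_def by (metis monoD)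

lemma jump_times_last_finite:
  assumes "jump_times T" "T j = \<infinity>"
  obtains J where "J < j" "T (Suc J) = \<infinity>" "T J < \<infinity>"
proof -
  define k where "k = (LEAST k. T k = \<infinity>)"
  have k: "T k = \<infinity>" "k \<le> j"
    unfolding k_def using assms by (auto intro: LeastI Least_le)
  have "T 0 \<noteq> \<infinity>" using assms by (simp add: jump_times_def)
  then obtain J where J: "k = Suc J" using k by (cases k) auto
  then have "T J \<noteq> \<infinity>" using not_less_Least[of J "\<lambda>k. T k = \<infinity>"] by (simp add: k_def)
  then show ?thesis using that[of J] k J by (auto simp: less_top)
qed

lemma jump_domain_unbounded:
  assumes T: "jump_times T"
  shows "\<exists>t j. (t, j) \<in> jump_domain T \<and> B \<le> t + real j"
proof (cases "\<exists>j. T j = \<infinity>")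
  case True
  then obtain J where J: "T (Suc J) = \<infinity>" "T J < \<infinity>"
    using jump_times_last_finite[OF T] by metis
  then obtain a where a: "T J = ereal a" using jump_times_nonneg[OF T, of J] by (cases "T J") auto
  show ?thesis
    by (rule exI[of _ "max a B"], rule exI[of _ J]) (use J a in auto)
next
  case False
  obtain n where n: "B \<le> real n" using real_arch_simple by blast
  obtain a where a: "T n = ereal a" "a \<ge> 0"
    using False jump_times_nonneg[OF T, of n] by (cases "T n") auto
  show ?thesis
    by (rule exI[of _ a], rule exI[of _ n]) (use n a jump_times_mono[OF T, of n "Suc n"] in auto)
qed

lemma complete_arc_jump_domain:
  assumes T: "jump_times T"
  shows "complete_arc (jump_domain T, x)"
proof -
  have "\<not> bounded ((\<lambda>(t, j). (t, real j)) ` jump_domain T)"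
  proof
    assume "bounded ((\<lambda>(t, j). (t, real j)) ` jump_domain T)"
    then obtain B where "\<forall>p\<in>(\<lambda>(t, j). (t, real j)) ` jump_domain T. norm p \<le> B"
      unfolding bounded_iff by blast
    then have B: "norm (t, real j) \<le> B" if "(t, j) \<in> jump_domain T" for t j
      using imageI[OF that, of "\<lambda>(t, j). (t, real j)"] by auto
    obtain t j where tj: "(t, j) \<in> jump_domain T" "2 * B + 1 \<le> t + real j"
      using jump_domain_unbounded[OF T] by blast
    have "\<bar>t\<bar> \<le> B" "\<bar>real j\<bar> \<le> B"
      using B[OF tj(1)] norm_fst_le[of t "real j"] norm_snd_le[of "real j" t] by auto
    then show False using tj(2) by auto
  qed
  then show ?thesis by (simp add: complete_arc_def)
qed

text \<open>Only two of the four shapes of a time domain are unbounded. Infinitely many pieces give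
  finite jump times, which may accumulate in finite time (Zeno behaviour); an unbounded last piece
  gives infinite jump times after \<open>J\<close>.\<close>

lemma complete_domain_is_jump_domain:
  assumes E: "hybrid_time_domain E" and c: "complete_arc (E, x)"
  obtains T where "jump_times T" "E = jump_domain T"
proof -
  obtain t :: "nat \<Rightarrow> real" where t: "t 0 = 0" "\<And>j. t j \<le> t (Suc j)" and
     alt: "E = (\<Union>j. {t j..t (Suc j)} \<times> {j}) \<or>
         (\<exists>J L. E = (\<Union>j<J. {t j..t (Suc j)} \<times> {j}) \<union> L \<times> {J} \<and>
            (L = {t J..t (Suc J)} \<or> t J < t (Suc J) \<and> L = {t J..<t (Suc J)} \<or> L = {t J..}))"
    using E unfolding hybrid_time_domain_def by blast
  have mt: "mono t" using t(2) by (simp add: mono_iff_le_Suc)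
  have bdd: False
    if E: "E = (\<Union>j<J. {t j..t (Suc j)} \<times> {j}) \<union> L \<times> {J}" and L: "L \<subseteq> {t J..t (Suc J)}" for J L
  proof -
    have "0 \<le> s \<and> s \<le> t (Suc J) \<and> j \<le> J" if sj: "(s, j) \<in> E" for s j
    proof -
      have "j \<le> J" "t j \<le> s" "s \<le> t (Suc j)" using sj L unfolding E by auto
      moreover have "0 \<le> t j" "t (Suc j) \<le> t (Suc J)"
        using monoD[OF mt, of 0 j] monoD[OF mt, of "Suc j" "Suc J"] t(1) \<open>j \<le> J\<close> by auto
      ultimately show ?thesis by linarith
    qed
    then have "(\<lambda>(t, j). (t, real j)) ` E \<subseteq> {0..t (Suc J)} \<times> {0..real J}" by auto
    then have "bounded ((\<lambda>(t, j). (t, real j)) ` E)"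
      by (rule bounded_subset[rotated]) (intro bounded_Times bounded_closed_interval)
    then show False using c by (simp add: complete_arc_def)
  qed
  show ?thesis
    using alt
  proof (elim disjE exE conjE)
    assume E: "E = (\<Union>j. {t j..t (Suc j)} \<times> {j})"
    have "jump_times (\<lambda>j. ereal (t j))"
      using mt t(1) by (simp add: jump_times_def mono_def)
    moreover have "E = jump_domain (\<lambda>j. ereal (t j))"
      unfolding E jump_domain_def by auto
    ultimately show ?thesis by (rule that)
  next
    fix J L assume E: "E = (\<Union>j<J. {t j..t (Suc j)} \<times> {j}) \<union> L \<times> {J}" and L: "L = {t J..}"
    define T where "T j = (if j \<le> J then ereal (t j) else \<infinity>)" for j
    have "(s, j) \<in> E \<longleftrightarrow> (s, j) \<in> jump_domain T" for s j
      unfolding E L T_def by (cases j J rule: linorder_cases) auto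
    then have "E = jump_domain T" by auto
    moreover have "jump_times T" using mt t(1) by (auto simp: jump_times_def mono_def T_def)
    ultimately show ?thesis using that by blast
  next
    fix J L assume E: "E = (\<Union>j<J. {t j..t (Suc j)} \<times> {j}) \<union> L \<times> {J}" and L: "L = {t J..t (Suc J)}"
    show ?thesis using bdd[OF E] L by simp
  next
    fix J L assume E: "E = (\<Union>j<J. {t j..t (Suc j)} \<times> {j}) \<union> L \<times> {J}" and L: "L = {t J..<t (Suc J)}"
    have "L \<subseteq> {t J..t (Suc J)}" unfolding L by auto
    then show ?thesis using bdd[OF E] by simp
  qed
qed

lemma hybrid_time_domain_jump_domain:
  assumes T: "jump_times T"
  shows "hybrid_time_domain (jump_domain T)"
proof (cases "\<exists>j. T j = \<infinity>")
  case False
  define t where "t j = real_of_ereal (T j)" for j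
  have tT: "T j = ereal (t j)" for j
    unfolding t_def using False jump_times_nonneg[OF T, of j] by (cases "T j") auto
  have "t 0 = 0" "\<And>j. t j \<le> t (Suc j)"
    using T jump_times_mono[OF T, of _ "Suc _"] tT by (auto simp: jump_times_def zero_ereal_def mono_iff_le_Suc)
  moreover have "jump_domain T = (\<Union>j. {t j..t (Suc j)} \<times> {j})"
    by (auto simp: jump_domain_def tT)
  ultimately show ?thesis unfolding hybrid_time_domain_def by blast
next
  case True
  then obtain J where J: "T (Suc J) = \<infinity>" "T J < \<infinity>"
    using jump_times_last_finite[OF T] by metis
  define t where "t j = real_of_ereal (T (min j J))" for j
  have tT: "T j = ereal (t j)" if "j \<le> J" for j
    using J jump_times_nonneg[OF T, of j] jump_times_mono[OF T that] that
    by (cases "T j") (auto simp: t_def min_def)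
  have inf: "T j = \<infinity>" if "j > J" for j
    using J jump_times_mono[OF T, of "Suc J" j] that by simp
  have "t 0 = 0" using tT[of 0] T by (simp add: jump_times_def zero_ereal_def)
  moreover have "t j \<le> t (Suc j)" for j
  proof (cases "j < J")
    case True
    then show ?thesis using tT[of j] tT[of "Suc j"] jump_times_mono[OF T, of j "Suc j"] by simp
  qed (simp add: t_def min_def)
  moreover have "jump_domain T = (\<Union>j<J. {t j..t (Suc j)} \<times> {j}) \<union> {t J..} \<times> {J}"
  proof -
    have "(s, j) \<in> jump_domain T \<longleftrightarrow> (s, j) \<in> (\<Union>j<J. {t j..t (Suc j)} \<times> {j}) \<union> {t J..} \<times> {J}" for s j
      using tT[of j] tT[of "Suc j"] inf[of j] J by (cases j J rule: linorder_cases) auto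
    then show ?thesis by auto
  qed
  ultimately show ?thesis unfolding hybrid_time_domain_def by blast
qed

lemma hybrid_time_domain_ordered:
  assumes E: "hybrid_time_domain E"
  shows "(s, j) \<in> E \<Longrightarrow> 0 \<le> s" and "(s, j) \<in> E \<Longrightarrow> (s', k) \<in> E \<Longrightarrow> j < k \<Longrightarrow> s \<le> s'"
proof -
  obtain t :: "nat \<Rightarrow> real" where t: "t 0 = 0" "\<And>j. t j \<le> t (Suc j)" and
     alt: "E = (\<Union>j. {t j..t (Suc j)} \<times> {j}) \<or>
         (\<exists>J L. E = (\<Union>j<J. {t j..t (Suc j)} \<times> {j}) \<union> L \<times> {J} \<and>
            (L = {t J..t (Suc J)} \<or> t J < t (Suc J) \<and> L = {t J..<t (Suc J)} \<or> L = {t J..}))"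
    using E unfolding hybrid_time_domain_def by blast
  have mt: "mono t" using t(2) by (simp add: mono_iff_le_Suc)
  \<comment> \<open>The upper bound is claimed only if a later index occurs: the last piece may be
    unbounded, and then \<open>t (Suc j)\<close> is no bound for it.\<close>
  have "t j \<le> s \<and> (\<forall>s' k. (s', k) \<in> E \<and> j < k \<longrightarrow> s \<le> t (Suc j))" if sj: "(s, j) \<in> E" for s j
    using alt
  proof (elim disjE exE)
    assume "E = (\<Union>j. {t j..t (Suc j)} \<times> {j})"
    then show ?thesis using sj by simp
  next
    fix J L assume *: "E = (\<Union>j<J. {t j..t (Suc j)} \<times> {j}) \<union> L \<times> {J} \<and>
            (L = {t J..t (Suc J)} \<or> t J < t (Suc J) \<and> L = {t J..<t (Suc J)} \<or> L = {t J..})"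
    then have "L \<subseteq> {t J..}" by auto
    moreover have E: "E = (\<Union>j<J. {t j..t (Suc j)} \<times> {j}) \<union> L \<times> {J}" using * by (rule conjunct1)
    moreover have "k \<le> J" if "(s', k) \<in> E" for s' k using that unfolding E by auto
    ultimately show ?thesis using sj by fastforce
  qed
  then have lower: "\<And>s j. (s, j) \<in> E \<Longrightarrow> t j \<le> s"
    and upper: "\<And>s j s' k. (s, j) \<in> E \<Longrightarrow> (s', k) \<in> E \<Longrightarrow> j < k \<Longrightarrow> s \<le> t (Suc j)" by blast+
  show "0 \<le> s" if "(s, j) \<in> E" using lower[OF that] monoD[OF mt, of 0 j] t(1) by simp
  assume a: "(s, j) \<in> E" "(s', k) \<in> E" "j < k"
  have "s \<le> t (Suc j)" using upper a by blast
  also have "\<dots> \<le> t k" using a monoD[OF mt, of "Suc j" k] by simp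
  also have "\<dots> \<le> s'" using lower a by blast
  finally show "s \<le> s'" .
qed

text \<open>A point \<open>(s, j)\<close> of \<open>E\<close> is trapped between the jump points
  \<open>(T j, j - 1)\<close> and \<open>(T (j + 1), j + 1)\<close>, which belong to the smaller
  domain when these times are finite. If \<open>T j\<close> is infinite, an earlier slice contains
  times beyond \<open>s\<close>, against the order of \<open>E\<close>.\<close>

lemma jump_domain_maximal:
  assumes T: "jump_times T" and E: "hybrid_time_domain E" and sub: "jump_domain T \<subseteq> E"
  shows "E = jump_domain T"
proof -
  have "(s, j) \<in> jump_domain T" if sj: "(s, j) \<in> E" for s j
  proof -
    have up: "ereal s \<le> T (Suc j)"
    proof (cases "T (Suc j)")
      case (real r)
      then have "(r, Suc j) \<in> E" using jump_times_mono[OF T, of "Suc j" "Suc (Suc j)"] sub by auto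
      then show ?thesis using hybrid_time_domain_ordered(2)[OF E sj] real by auto
    qed (use jump_times_nonneg[OF T, of "Suc j"] in auto)
    have "T j \<le> ereal s"
    proof (cases "T j")
      case (real r)
      show ?thesis
      proof (cases j)
        case 0
        then show ?thesis using T hybrid_time_domain_ordered(1)[OF E sj] by (simp add: jump_times_def)
      next
        case (Suc i)
        then have "(r, i) \<in> E" using jump_times_mono[OF T, of i j] real sub by auto
        then show ?thesis using hybrid_time_domain_ordered(2)[OF E _ sj] real Suc by auto
      qed
    next
      case PInf
      then obtain J where J: "J < j" "T (Suc J) = \<infinity>" "T J < \<infinity>"
        using jump_times_last_finite[OF T] by metis
      then obtain a where a: "T J = ereal a" using jump_times_nonneg[OF T, of J] by (cases "T J") auto
      then have "(max a (s + 1), J) \<in> E" using J sub by auto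
      then have "max a (s + 1) \<le> s" using hybrid_time_domain_ordered(2)[OF E _ sj] J by blast
      then show ?thesis by simp
    qed (use jump_times_nonneg[OF T, of j] in auto)
    then show ?thesis using up by simp
  qed
  then show ?thesis using sub by auto
qed

text \<open>Stability and basins speak of maximal solutions, so this is what brings the limit arcs
  under the hypotheses. An extension would need a strictly larger time domain.\<close>

lemma maximal_solution_jump_domain:
  assumes T: "jump_times T" and sol: "solution H (jump_domain T, x)"
  shows "maximal_solution H (jump_domain T, x)"
  using jump_domain_maximal[OF T] sol
  unfolding maximal_solution_def solution_def hybrid_arc_def by blast

section \<open>Compactness of bounded complete solutions\<close>

lemma osc_limit:
  assumes osc: "outer_semicontinuous_on S M" and x: "x \<in> S"
    and ev: "\<forall>\<^sub>F i in sequentially. u i \<in> S \<and> v i \<in> M (u i)"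
    and lim: "u \<longlonglongrightarrow> x" "v \<longlonglongrightarrow> y"
  shows "y \<in> M x"
proof -
  obtain N where N: "\<And>i. i \<ge> N \<Longrightarrow> u i \<in> S \<and> v i \<in> M (u i)"
    using ev unfolding eventually_sequentially by blast
  have "\<forall>i. u (i + N) \<in> S \<and> v (i + N) \<in> M (u (i + N))" using N by simp
  moreover have "(\<lambda>i. u (i + N)) \<longlonglongrightarrow> x" "(\<lambda>i. v (i + N)) \<longlonglongrightarrow> y"
    using lim LIMSEQ_ignore_initial_segment by blast+
  ultimately show ?thesis using osc x unfolding outer_semicontinuous_on_def by metis
qed

lemma locally_bounded_on_compact:
  assumes lb: "locally_bounded_on S M" and K: "compact K" "K \<subseteq> S"
  shows "bounded (\<Union>x\<in>K. M x)"
proof -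
  have "\<forall>x\<in>K. \<exists>U. open U \<and> x \<in> U \<and> bounded (\<Union>y\<in>U \<inter> S. M y)"
    using lb K(2) unfolding locally_bounded_on_def by blast
  then obtain U where U: "\<And>x. x \<in> K \<Longrightarrow> open (U x) \<and> x \<in> U x \<and> bounded (\<Union>y\<in>U x \<inter> S. M y)"
    by metis
  obtain F where F: "F \<subseteq> K" "finite F" "K \<subseteq> (\<Union>x\<in>F. U x)"
  proof (rule compactE_image[OF K(1), of K U])
    show "\<And>x. x \<in> K \<Longrightarrow> open (U x)" using U by blast
    show "K \<subseteq> (\<Union>x\<in>K. U x)" using U by blast
  qed
  have "bounded (\<Union>x\<in>F. \<Union>y\<in>U x \<inter> S. M y)"
    using F(1,2) U by (intro bounded_UN) auto
  then show ?thesis by (rule bounded_subset) (use F(3) K(2) in blast)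
qed

text \<open>Upper semicontinuity of the support function of \<open>M\<close> in direction
  \<open>a\<close>. Otherwise velocities violating the bound accumulate at some \<open>w\<close> by
  local boundedness; outer semicontinuity puts \<open>w\<close> into \<open>M x\<close>, although
  \<open>a \<bullet> w \<ge> b\<close>.\<close>

lemma osc_inner_upper_bound:
  fixes M :: "'a::euclidean_space \<Rightarrow> 'a set"
  assumes osc: "outer_semicontinuous_on S M" and lb: "locally_bounded_on S M" and x: "x \<in> S"
    and lt: "\<And>v. v \<in> M x \<Longrightarrow> a \<bullet> v < b"
  shows "\<exists>\<delta>>0. \<forall>z v. z \<in> S \<and> dist z x < \<delta> \<and> v \<in> M z \<longrightarrow> a \<bullet> v \<le> b"
proof (rule ccontr)
  assume neg: "\<not> ?thesis"
  have "\<exists>p. fst p \<in> S \<and> dist (fst p) x < inverse (Suc n) \<and> snd p \<in> M (fst p) \<and> a \<bullet> snd p > b" for n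
  proof -
    have "inverse (real (Suc n)) > 0" by simp
    with neg obtain z v where "z \<in> S" "dist z x < inverse (Suc n)" "v \<in> M z" "\<not> a \<bullet> v \<le> b" by blast
    then show ?thesis by (intro exI[of _ "(z, v)"]) simp
  qed
  then obtain p where p: "\<And>n. fst (p n) \<in> S \<and> dist (fst (p n)) x < inverse (Suc n) \<and>
      snd (p n) \<in> M (fst (p n)) \<and> a \<bullet> snd (p n) > b"
    by metis
  define z v where "z n = fst (p n)" and "v n = snd (p n)" for n
  have zv: "z n \<in> S" "dist (z n) x < inverse (Suc n)" "v n \<in> M (z n)" "a \<bullet> v n > b" for n
    using p[of n] by (simp_all add: z_def v_def)
  have zx: "z \<longlonglongrightarrow> x"
  proof -
    have "\<forall>\<^sub>F n in sequentially. norm (dist (z n) x) \<le> inverse (real (Suc n))"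
    proof (rule always_eventually, rule allI)
      show "norm (dist (z n) x) \<le> inverse (real (Suc n))" for n
        using less_imp_le[OF zv(2)[of n]] by (simp only: real_norm_def abs_of_nonneg[OF zero_le_dist])
    qed
    then have "(\<lambda>n. dist (z n) x) \<longlonglongrightarrow> 0"
      by (rule Lim_null_comparison[OF _ LIMSEQ_inverse_real_of_nat])
    then show ?thesis by (rule iffD2[OF tendsto_dist_iff])
  qed
  have "compact (insert x (range z))" by (rule compact_sequence_with_limit[OF zx])
  then have "bounded (\<Union>y\<in>insert x (range z). M y)"
    using zv(1) x by (intro locally_bounded_on_compact[OF lb]) auto
  then have "bounded (range v)"
    by (rule bounded_subset) (use zv(3) in auto)
  then obtain w r where r: "strict_mono (r :: nat \<Rightarrow> nat)" "(v \<circ> r) \<longlonglongrightarrow> w"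
    using bounded_imp_convergent_subsequence by blast
  have "w \<in> M x"
    by (rule osc_limit[OF osc x, of "z \<circ> r" "v \<circ> r"])
       (use zv(1,3) r LIMSEQ_subseq_LIMSEQ[OF zx] in auto)
  then have "a \<bullet> w < b" by (rule lt)
  moreover have "b \<le> a \<bullet> w"
    by (rule LIMSEQ_le_const[OF tendsto_inner[OF tendsto_const r(2)]])
       (use zv(4) in \<open>auto intro: less_imp_le\<close>)
  ultimately show False by simp
qed

section \<open>The integrated form of the flow condition\<close>

lemma absolutely_continuous_on_inner:
  assumes "absolutely_continuous_on I f"
  shows "absolutely_continuous_on I (\<lambda>t. a \<bullet> f t)"
  unfolding absolutely_continuous_on_def
proof (intro allI impI)
  fix e :: real assume "e > 0"
  then have "e / (norm a + 1) > 0" by (simp add: add_nonneg_pos)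
  then obtain \<delta> where \<delta>: "\<delta> > 0" "\<And>d S. S \<subseteq> I \<and> d division_of S \<and> (\<Sum>K\<in>d. measure lborel K) < \<delta> \<Longrightarrow>
        (\<Sum>K\<in>d. norm (f (Sup K) - f (Inf K))) < e / (norm a + 1)"
    using assms unfolding absolutely_continuous_on_def by meson
  have "(\<Sum>K\<in>d. norm (a \<bullet> f (Sup K) - a \<bullet> f (Inf K))) < e"
    if "S \<subseteq> I \<and> d division_of S \<and> (\<Sum>K\<in>d. measure lborel K) < \<delta>" for d S
  proof -
    have "(\<Sum>K\<in>d. norm (a \<bullet> f (Sup K) - a \<bullet> f (Inf K))) \<le> (\<Sum>K\<in>d. (norm a + 1) * norm (f (Sup K) - f (Inf K)))"
    proof (rule sum_mono)
      fix K
      have "norm (a \<bullet> f (Sup K) - a \<bullet> f (Inf K)) \<le> norm a * norm (f (Sup K) - f (Inf K))"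
        by (simp add: inner_diff_right[symmetric] Cauchy_Schwarz_ineq2)
      also have "\<dots> \<le> (norm a + 1) * norm (f (Sup K) - f (Inf K))" by (intro mult_right_mono) auto
      finally show "norm (a \<bullet> f (Sup K) - a \<bullet> f (Inf K)) \<le> (norm a + 1) * norm (f (Sup K) - f (Inf K))" .
    qed
    also have "\<dots> = (norm a + 1) * (\<Sum>K\<in>d. norm (f (Sup K) - f (Inf K)))" by (simp add: sum_distrib_left)
    also have "\<dots> < (norm a + 1) * (e / (norm a + 1))"
      using \<delta>(2)[OF that] by (intro mult_strict_left_mono) (auto simp: add_nonneg_pos)
    also have "\<dots> = e" by (simp add: add_nonneg_eq_0_iff)
    finally show ?thesis .
  qed
  then show "\<exists>\<delta>>0. \<forall>d S. S \<subseteq> I \<and> d division_of S \<and> (\<Sum>K\<in>d. measure lborel K) < \<delta> \<longrightarrow>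
     (\<Sum>K\<in>d. norm (a \<bullet> f (Sup K) - a \<bullet> f (Inf K))) < e"
    using \<delta>(1) by blast
qed

lemma absolutely_continuous_on_lipschitz:
  fixes f :: "real \<Rightarrow> 'a::real_normed_vector"
  assumes lip: "\<And>s t. s \<in> {a..b} \<Longrightarrow> t \<in> {a..b} \<Longrightarrow> norm (f s - f t) \<le> M * \<bar>s - t\<bar>"
  shows "absolutely_continuous_on {a..b} f"
  unfolding absolutely_continuous_on_def
proof (intro allI impI)
  fix e :: real assume "e > 0"
  define \<delta> where "\<delta> = e / (\<bar>M\<bar> + 1)"
  have "\<delta> > 0" using \<open>e > 0\<close> by (simp add: \<delta>_def add_nonneg_pos)
  have "(\<Sum>K\<in>d. norm (f (Sup K) - f (Inf K))) < e"
    if d: "S \<subseteq> {a..b}" "d division_of S" "(\<Sum>K\<in>d. measure lborel K) < \<delta>" for d S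
  proof -
    have "(\<Sum>K\<in>d. norm (f (Sup K) - f (Inf K))) \<le> (\<Sum>K\<in>d. (\<bar>M\<bar> + 1) * measure lborel K)"
    proof (rule sum_mono)
      fix K assume K: "K \<in> d"
      obtain u v where Kuv: "K = {u..v}" using division_ofD(4)[OF d(2) K] by auto
      have "K \<noteq> {}" "K \<subseteq> {a..b}" using division_ofD(2,3)[OF d(2) K] d(1) by auto
      then have uv: "K = {u..v}" "u \<le> v" "{u..v} \<subseteq> {a..b}" using Kuv by auto
      then have "norm (f v - f u) \<le> M * \<bar>v - u\<bar>" by (intro lip) auto
      also have "\<dots> \<le> (\<bar>M\<bar> + 1) * \<bar>v - u\<bar>" by (intro mult_right_mono) auto
      finally show "norm (f (Sup K) - f (Inf K)) \<le> (\<bar>M\<bar> + 1) * measure lborel K"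
        using uv by simp
    qed
    also have "\<dots> = (\<bar>M\<bar> + 1) * (\<Sum>K\<in>d. measure lborel K)" by (simp add: sum_distrib_left)
    also have "\<dots> < (\<bar>M\<bar> + 1) * \<delta>" using d(3) by (intro mult_strict_left_mono) auto
    also have "\<dots> = e" by (simp add: \<delta>_def add_nonneg_eq_0_iff)
    finally show ?thesis .
  qed
  then show "\<exists>\<delta>>0. \<forall>d S. S \<subseteq> {a..b} \<and> d division_of S \<and> (\<Sum>K\<in>d. measure lborel K) < \<delta> \<longrightarrow>
     (\<Sum>K\<in>d. norm (f (Sup K) - f (Inf K))) < e"
    using \<open>\<delta> > 0\<close> by blast
qed

lemma jump_domain_between:
  assumes "(s, j) \<in> jump_domain T" "(t, j) \<in> jump_domain T" "s \<le> r" "r \<le> t"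
  shows "(r, j) \<in> jump_domain T"
  using assms order_trans[of "T j" "ereal s" "ereal r"] order_trans[of "ereal r" "ereal t" "T (Suc j)"]
  by simp

text \<open>The flow condition is replaced by integrated consequences, which can be used along convergent
  sequences of arcs although the derivatives need not converge.\<close>

definition regular_arc :: "'a::euclidean_space hybrid_system \<Rightarrow> real \<Rightarrow> (nat \<Rightarrow> ereal) \<Rightarrow> (real \<Rightarrow> nat \<Rightarrow> 'a) \<Rightarrow> bool" where
  "regular_arc H M T x \<longleftrightarrow> jump_times T \<and>
     (\<forall>j s t. (s, j) \<in> jump_domain T \<and> (t, j) \<in> jump_domain T \<and> s \<le> t \<longrightarrow>
        norm (x t j - x s j) \<le> M * (t - s)) \<and>
     (\<forall>j t. (t, j) \<in> jump_domain T \<and> ereal t < T (Suc j) \<longrightarrow> x t j \<in> flow_set H) \<and>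
     (\<forall>j s t a b. (s, j) \<in> jump_domain T \<and> (t, j) \<in> jump_domain T \<and> s \<le> t \<and>
        (\<forall>r v. s \<le> r \<and> r < t \<and> v \<in> flow_map H (x r j) \<longrightarrow> a \<bullet> v \<le> b) \<longrightarrow>
        a \<bullet> (x t j - x s j) \<le> b * (t - s)) \<and>
     (\<forall>j t. (t, j) \<in> jump_domain T \<and> (t, Suc j) \<in> jump_domain T \<longrightarrow>
        x t j \<in> jump_set H \<and> x t (Suc j) \<in> jump_map H (x t j))"

text \<open>Pairing with a fixed \<open>a\<close> turns the differential inclusion into a bound on
  the derivative of a real function, to which the mean value inequality applies.\<close>

lemma solution_scalar_mean_value:
  assumes sol: "solution H (jump_domain T, x)"
    and s: "(s, j) \<in> jump_domain T" and t: "(t, j) \<in> jump_domain T" and st: "s \<le> t"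
    and le: "\<And>r v. s \<le> r \<Longrightarrow> r < t \<Longrightarrow> v \<in> flow_map H (x r j) \<Longrightarrow> a \<bullet> v \<le> b"
  shows "a \<bullet> (x t j - x s j) \<le> b * (t - s)"
proof (cases "s = t")
  case False
  let ?I = "time_slice (jump_domain T) j"
  have sub: "{s..t} \<subseteq> ?I"
    using jump_domain_between[OF s t] unfolding time_slice_def by auto
  have "interior {s..t} \<noteq> {}" using False st by simp
  then have ne: "interior ?I \<noteq> {}" using interior_mono[OF sub] by blast
  have AE: "AE r in lebesgue. r \<in> ?I \<longrightarrow>
           (\<exists>v\<in>flow_map H (x r j). ((\<lambda>s. x s j) has_vector_derivative v) (at r within ?I))"
    and lac: "locally_absolutely_continuous_on ?I (\<lambda>t. x t j)"
    using sol ne unfolding solution_def hybrid_arc_def by auto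
  obtain N where N: "N \<in> null_sets lebesgue"
      "{r \<in> space lebesgue. \<not> (r \<in> ?I \<longrightarrow>
           (\<exists>v\<in>flow_map H (x r j). ((\<lambda>s. x s j) has_vector_derivative v) (at r within ?I)))} \<subseteq> N"
    using AE unfolding eventually_ae_filter by blast
  \<comment> \<open>The velocities are bounded for \<open>r < t\<close> only, so the right end joins
    the null set.\<close>
  have "negligible (insert t N)" using N(1) by (simp add: negligible_iff_null_sets[symmetric])
  moreover have "absolutely_continuous_on {s..t} (\<lambda>r. a \<bullet> x r j)"
    using lac sub unfolding locally_absolutely_continuous_on_def by (intro absolutely_continuous_on_inner) blast
  moreover have "\<exists>v\<le>b. ((\<lambda>r. a \<bullet> x r j) has_vector_derivative v) (at r within {s..t})"
    if r: "r \<in> {s..t} - insert t N" for r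
  proof -
    have "r \<in> ?I" using r sub by auto
    then obtain v where v: "v \<in> flow_map H (x r j)" "((\<lambda>s. x s j) has_vector_derivative v) (at r within ?I)"
      using N(2) r by auto
    have "((\<lambda>s. x s j) has_vector_derivative v) (at r within {s..t})"
      using v(2) sub by (rule has_vector_derivative_within_subset)
    then have "((\<lambda>r. a \<bullet> x r j) has_vector_derivative a \<bullet> v) (at r within {s..t})"
      by (rule bounded_linear.has_vector_derivative[OF bounded_linear_inner_right])
    moreover have "a \<bullet> v \<le> b" using le[of r v] v(1) r by auto
    ultimately show ?thesis by blast
  qed
  ultimately have "a \<bullet> x t j - a \<bullet> x s j \<le> b * (t - s)"
    using increment_le_of_derivative_ae_le[of s t "\<lambda>r. a \<bullet> x r j" "insert t N" b] st by blast
  then show ?thesis by (simp add: inner_diff_right)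
qed simp

lemma regular_arc_of_bounded_solution:
  fixes H :: "'a::euclidean_space hybrid_system"
  assumes H: "basic_assumptions H" and T: "jump_times T" and sol: "solution H (jump_domain T, x)"
    and K: "compact K" and xK: "\<And>t j. (t, j) \<in> jump_domain T \<Longrightarrow> x t j \<in> K"
  obtains M where "regular_arc H M T x"
proof -
  have clC: "closed (flow_set H)" and lb: "locally_bounded_on (flow_set H) (flow_map H)"
    using H by (auto simp: basic_assumptions_def)
  have "bounded (\<Union>z\<in>K \<inter> flow_set H. flow_map H z)"
    using K clC by (intro locally_bounded_on_compact[OF lb] compact_Int_closed) auto
  then obtain M where M: "\<And>z v. z \<in> K \<Longrightarrow> z \<in> flow_set H \<Longrightarrow> v \<in> flow_map H z \<Longrightarrow> norm v \<le> M"
    unfolding bounded_iff by blast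
  have flow: "x t j \<in> flow_set H" if tj: "(t, j) \<in> jump_domain T" "ereal t < T (Suc j)" for t j
  proof -
    obtain s where s: "t < s" "ereal s \<le> T (Suc j)"
      using tj(2) by (metis ereal_dense2 ereal_less(2) less_eq_ereal_def less_ereal.simps(1))
    let ?I = "time_slice (jump_domain T) j"
    have "{t..s} \<subseteq> ?I"
    proof
      fix r assume "r \<in> {t..s}"
      then have "ereal t \<le> ereal r" "ereal r \<le> ereal s" by auto
      then have "T j \<le> ereal r" "ereal r \<le> T (Suc j)"
        using tj(1) s(2) order_trans[of "T j" "ereal t" "ereal r"] order_trans[of "ereal r" "ereal s" "T (Suc j)"]
        unfolding mem_jump_domain by blast+
      then show "r \<in> ?I" by (simp add: time_slice_jump_domain)
    qed
    moreover have "interior {t..s} \<noteq> {}" using s by simp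
    ultimately have "interior ?I \<noteq> {}" using interior_mono by blast
    moreover have "t \<in> ?I" "s \<in> ?I" using \<open>{t..s} \<subseteq> ?I\<close> s by auto
    ultimately show ?thesis using sol s(1) unfolding solution_def by blast
  qed
  have lip: "norm (x t j - x s j) \<le> M * (t - s)"
    if s: "(s, j) \<in> jump_domain T" and t: "(t, j) \<in> jump_domain T" and st: "s \<le> t" for s t j
  proof -
    \<comment> \<open>The displacement itself serves as the direction: the left-hand side becomes
      the square of \<open>norm a\<close>, and one factor cancels.\<close>
    define a where "a = x t j - x s j"
    have "a \<bullet> (x t j - x s j) \<le> norm a * M * (t - s)"
    proof (rule solution_scalar_mean_value[OF sol s t st])
      fix r v assume r: "s \<le> r" "r < t" "v \<in> flow_map H (x r j)"
      have "(r, j) \<in> jump_domain T" using jump_domain_between[OF s t, of r] r by simp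
      moreover have "ereal r < T (Suc j)"
        using less_le_trans[of "ereal r" "ereal t" "T (Suc j)"] r(2) t by simp
      ultimately have "norm v \<le> M" using M xK flow r(3) by blast
      then have "norm a * norm v \<le> norm a * M" by (intro mult_left_mono) auto
      then show "a \<bullet> v \<le> norm a * M" using norm_cauchy_schwarz[of a v] by linarith
    qed
    then have "norm a * norm a \<le> norm a * (M * (t - s))"
      by (simp add: a_def[symmetric] power2_norm_eq_inner[symmetric] power2_eq_square mult.assoc)
    then have "norm a \<le> M * (t - s)" if "a \<noteq> 0" using that by simp
    \<comment> \<open>\<open>M\<close> bounds a set that might be empty, so it could be negative; a
      velocity at \<open>x s j\<close> excludes this. This settles the case
      \<open>a = 0\<close>.\<close>
    moreover have "M * (t - s) \<ge> 0" if "s < t"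
    proof -
      have "ereal s < T (Suc j)" using that t by (auto intro: less_le_trans[of "ereal s" "ereal t"])
      then have "x s j \<in> flow_set H" using flow s by blast
      moreover then obtain v where "v \<in> flow_map H (x s j)" using H by (auto simp: basic_assumptions_def)
      ultimately have "0 \<le> M" using M[of "x s j" v] xK[OF s] norm_ge_zero[of v] by linarith
      then show ?thesis using that by simp
    qed
    ultimately show ?thesis using st unfolding a_def by (cases "s = t") (auto, fastforce)
  qed
  have "regular_arc H M T x"
    unfolding regular_arc_def
  proof (intro conjI allI impI)
    show "jump_times T" by fact
    show "a \<bullet> (x t j - x s j) \<le> b * (t - s)"
      if "(s, j) \<in> jump_domain T \<and> (t, j) \<in> jump_domain T \<and> s \<le> t \<and>
        (\<forall>r v. s \<le> r \<and> r < t \<and> v \<in> flow_map H (x r j) \<longrightarrow> a \<bullet> v \<le> b)" for j s t a b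
      using that by (intro solution_scalar_mean_value[OF sol]) blast+
    show "x t j \<in> jump_set H" "x t (Suc j) \<in> jump_map H (x t j)"
      if "(t, j) \<in> jump_domain T \<and> (t, Suc j) \<in> jump_domain T" for j t
      using that sol unfolding solution_def by blast+
  qed (use lip flow in blast)+
  then show ?thesis by (rule that)
qed

section \<open>Time shifts\<close>

text \<open>Slice \<open>k\<close> is cut at \<tau>, so its left end becomes 0 instead of the
  possibly negative \<open>T k - ereal \<tau>\<close>. Infinite jump times stay infinite.\<close>

definition shift_times :: "(nat \<Rightarrow> ereal) \<Rightarrow> real \<Rightarrow> nat \<Rightarrow> nat \<Rightarrow> ereal" where
  "shift_times T \<tau> k j = (if j = 0 then 0 else T (k + j) - ereal \<tau>)"

lemma ereal_le_diff_real: "a - ereal \<tau> \<le> ereal t \<longleftrightarrow> a \<le> ereal (\<tau> + t)"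
  and ereal_le_diff_real': "ereal t \<le> a - ereal \<tau> \<longleftrightarrow> ereal (\<tau> + t) \<le> a"
  and ereal_less_diff_real: "ereal t < a - ereal \<tau> \<longleftrightarrow> ereal (\<tau> + t) < a"
  by (cases a; auto)+

lemma mem_shift_times:
  assumes T: "jump_times T" and p: "(\<tau>, k) \<in> jump_domain T"
  shows "(t, j) \<in> jump_domain (shift_times T \<tau> k) \<longleftrightarrow> 0 \<le> t \<and> (\<tau> + t, k + j) \<in> jump_domain T"
proof (cases j)
  case 0
  have "T k \<le> ereal (\<tau> + t)" if "0 \<le> t"
    using p that by (auto intro: order_trans[of "T k" "ereal \<tau>"])
  then show ?thesis using 0 by (auto simp: shift_times_def ereal_le_diff_real' zero_ereal_def)
next
  case (Suc i)
  \<comment> \<open>Slices after the cut one begin no earlier than the jump that ends slice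
    \<open>k\<close>, so the condition \<open>0 \<le> t\<close> is automatic there.\<close>
  have "0 \<le> t" if "T (Suc (k + i)) \<le> ereal (\<tau> + t)"
  proof -
    have "ereal \<tau> \<le> T (Suc k)" using p by simp
    also have "\<dots> \<le> T (Suc (k + i))" by (rule jump_times_mono[OF T]) simp
    also have "\<dots> \<le> ereal (\<tau> + t)" by (rule that)
    finally have "ereal \<tau> \<le> ereal (\<tau> + t)" .
    then show ?thesis by simp
  qed
  then show ?thesis using Suc by (auto simp: shift_times_def ereal_le_diff_real ereal_le_diff_real')
qed

lemma jump_times_shift:
  assumes T: "jump_times T" and p: "(\<tau>, k) \<in> jump_domain T"
  shows "jump_times (shift_times T \<tau> k)"
proof -
  have "shift_times T \<tau> k j \<le> shift_times T \<tau> k (Suc j)" for j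
  proof (cases j)
    case 0
    have "ereal 0 \<le> T (Suc k) - ereal \<tau>" unfolding ereal_le_diff_real' using p by simp
    then show ?thesis using 0 by (simp add: shift_times_def zero_ereal_def)
  next
    case (Suc i)
    then show ?thesis using jump_times_mono[OF T, of "k + j" "k + Suc j"]
      by (auto simp: shift_times_def intro!: ereal_minus_mono)
  qed
  then show ?thesis by (simp add: jump_times_def mono_iff_le_Suc) (simp add: shift_times_def)
qed

lemma regular_arc_shift:
  assumes reg: "regular_arc H M T x" and p: "(\<tau>, k) \<in> jump_domain T"
  shows "regular_arc H M (shift_times T \<tau> k) (\<lambda>t j. x (\<tau> + t) (k + j))"
proof -
  have T: "jump_times T" using reg by (simp add: regular_arc_def)
  note mem = mem_shift_times[OF T p]
  have less: "ereal t < shift_times T \<tau> k (Suc j) \<longleftrightarrow> ereal (\<tau> + t) < T (Suc (k + j))" for t j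
    by (simp add: shift_times_def ereal_less_diff_real)
  show ?thesis
    unfolding regular_arc_def mem less
  proof (intro conjI allI impI)
    show "jump_times (shift_times T \<tau> k)" by (rule jump_times_shift[OF T p])
    show "norm (x (\<tau> + t) (k + j) - x (\<tau> + s) (k + j)) \<le> M * (t - s)"
      if "(0 \<le> s \<and> (\<tau> + s, k + j) \<in> jump_domain T) \<and> (0 \<le> t \<and> (\<tau> + t, k + j) \<in> jump_domain T) \<and> s \<le> t" for j s t
    proof -
      have "norm (x (\<tau> + t) (k + j) - x (\<tau> + s) (k + j)) \<le> M * ((\<tau> + t) - (\<tau> + s))"
        using reg that unfolding regular_arc_def by (meson add_left_mono)
      then show ?thesis by simp
    qed
    show "a \<bullet> (x (\<tau> + t) (k + j) - x (\<tau> + s) (k + j)) \<le> b * (t - s)"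
      if *: "(0 \<le> s \<and> (\<tau> + s, k + j) \<in> jump_domain T) \<and> (0 \<le> t \<and> (\<tau> + t, k + j) \<in> jump_domain T) \<and> s \<le> t \<and>
        (\<forall>r v. s \<le> r \<and> r < t \<and> v \<in> flow_map H (x (\<tau> + r) (k + j)) \<longrightarrow> a \<bullet> v \<le> b)" for j s t a b
    proof -
      have "\<forall>r v. \<tau> + s \<le> r \<and> r < \<tau> + t \<and> v \<in> flow_map H (x r (k + j)) \<longrightarrow> a \<bullet> v \<le> b"
      proof (intro allI impI)
        fix r v assume "\<tau> + s \<le> r \<and> r < \<tau> + t \<and> v \<in> flow_map H (x r (k + j))"
        then show "a \<bullet> v \<le> b" using *[THEN conjunct2, THEN conjunct2, THEN conjunct2, rule_format, of "r - \<tau>" v]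
          by auto
      qed
      then have "a \<bullet> (x (\<tau> + t) (k + j) - x (\<tau> + s) (k + j)) \<le> b * ((\<tau> + t) - (\<tau> + s))"
        using reg * unfolding regular_arc_def by (meson add_left_mono)
      then show ?thesis by simp
    qed
    show "x (\<tau> + t) (k + j) \<in> flow_set H"
      if "(0 \<le> t \<and> (\<tau> + t, k + j) \<in> jump_domain T) \<and> ereal (\<tau> + t) < T (Suc (k + j))" for j t
      using reg that unfolding regular_arc_def by blast
    show "x (\<tau> + t) (k + j) \<in> jump_set H" "x (\<tau> + t) (k + Suc j) \<in> jump_map H (x (\<tau> + t) (k + j))"
      if "(0 \<le> t \<and> (\<tau> + t, k + j) \<in> jump_domain T) \<and> 0 \<le> t \<and> (\<tau> + t, k + Suc j) \<in> jump_domain T" for j t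
      using reg that unfolding regular_arc_def add_Suc_right by blast+
  qed
qed

section \<open>Selection of convergent subsequences\<close>

text \<open>The jump times of shifted arcs have no common bound, hence limits in the compact space
  of extended reals; a limit \<infinity> means that the limit arc flows for ever instead of jumping
  again.\<close>

lemma ereal_diagonal_subsequence:
  fixes S :: "nat \<Rightarrow> nat \<Rightarrow> ereal"
  obtains r T where "strict_mono r" "\<forall>j. (\<lambda>i. S (r i) j) \<longlonglongrightarrow> T j"
proof -
  define P where "P n s \<longleftrightarrow> (\<exists>l. (\<lambda>i. S (s i) n) \<longlonglongrightarrow> l)" for n and s :: "nat \<Rightarrow> nat"
  interpret subseqs P
  proof
    fix n and s :: "nat \<Rightarrow> nat"
    obtain l r where "strict_mono r" "((\<lambda>i. S (s i) n) \<circ> r) \<longlonglongrightarrow> l"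
      using compact_complete_linorder[of "\<lambda>i. S (s i) n"] by blast
    then show "\<exists>r'. strict_mono r' \<and> P n (s \<circ> r')"
      unfolding P_def o_def by blast
  qed
  have "\<exists>l. (\<lambda>i. S (diagseq i) k) \<longlonglongrightarrow> l" for k
  proof -
    \<comment> \<open>Only this tail of the diagonal sequence is a subsequence of the one selected
      for coordinate \<open>k\<close>.\<close>
    have "P k (diagseq \<circ> (+) (Suc k))"
    proof (rule diagseq_holds)
      fix r s :: "nat \<Rightarrow> nat" and n assume r: "strict_mono r" and "P n s"
      then obtain l where "(\<lambda>i. S (s i) n) \<longlonglongrightarrow> l" by (auto simp: P_def)
      from LIMSEQ_subseq_LIMSEQ[OF this r] show "P n (s \<circ> r)" unfolding P_def o_def by blast
    qed
    then obtain l where "(\<lambda>i. S (diagseq (i + Suc k)) k) \<longlonglongrightarrow> l"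
      by (auto simp: P_def o_def add.commute)
    then show ?thesis using LIMSEQ_offset[of "\<lambda>i. S (diagseq i) k"] by blast
  qed
  then obtain T where "\<And>k. (\<lambda>i. S (diagseq i) k) \<longlonglongrightarrow> T k" by metis
  then show ?thesis using that subseq_diagseq by blast
qed

text \<open>The equicontinuity half of the Arzela-Ascoli argument, by three errors of size
  \<open>e / 3\<close>; the diagonal selection supplies convergence at rational times.\<close>

lemma equi_lipschitz_convergent:
  fixes Z :: "nat \<Rightarrow> real \<Rightarrow> 'a::banach"
  assumes lip: "\<And>i s t. norm (Z i s - Z i t) \<le> L * \<bar>s - t\<bar>"
    and conv: "\<And>q. q \<in> \<rat> \<Longrightarrow> convergent (\<lambda>i. Z i q)"
  shows "convergent (\<lambda>i. Z i t)"
proof -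
  have L: "L \<ge> 0" using order_trans[OF norm_ge_zero lip[of 0 0 1]] by simp
  have "Cauchy (\<lambda>i. Z i t)"
  proof (rule metric_CauchyI)
    fix e :: real assume e: "e > 0"
    define d where "d = e / (3 * (L + 1))"
    have d: "d > 0" "L * d < e / 3"
      using e L by (auto simp: d_def field_simps)
    obtain q where q: "q \<in> \<rat>" "t < q" "q < t + d" using Rats_dense_in_real[of t "t + d"] d by auto
    obtain N where N: "\<And>m n. m \<ge> N \<Longrightarrow> n \<ge> N \<Longrightarrow> dist (Z m q) (Z n q) < e / 3"
      using metric_CauchyD[OF convergent_Cauchy[OF conv[OF q(1)]], of "e / 3"] e by auto
    have close: "dist (Z m t) (Z m q) < e / 3" for m
    proof -
      have "dist (Z m t) (Z m q) \<le> L * \<bar>t - q\<bar>" using lip by (simp add: dist_norm)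
      also have "\<dots> \<le> L * d" using q L by (intro mult_left_mono) auto
      finally show ?thesis using d by simp
    qed
    show "\<exists>N. \<forall>m\<ge>N. \<forall>n\<ge>N. dist (Z m t) (Z n t) < e"
    proof (intro exI allI impI)
      fix m n assume "m \<ge> N" "n \<ge> N"
      then show "dist (Z m t) (Z n t) < e"
        using N[of m n] close[of m] close[of n] dist_triangle[of "Z m t" "Z n t" "Z m q"]
          dist_triangle[of "Z m q" "Z n t" "Z n q"] by (simp add: dist_commute)
    qed
  qed
  then show ?thesis by (rule Cauchy_convergent)
qed

text \<open>Clamping the time to the \<open>j\<close>-th slice makes the arcs of a sequence comparable although
  their jump times differ.\<close>

definition clamp_time :: "(nat \<Rightarrow> ereal) \<Rightarrow> real \<Rightarrow> nat \<Rightarrow> real" where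
  "clamp_time T t j = real_of_ereal (max (T j) (min (ereal t) (T (Suc j))))"

text \<open>An infinite left end marks an empty slice. The value 0 there keeps the norm bound and
  the Lipschitz bound valid on every slice.\<close>

definition clamped_arc :: "(nat \<Rightarrow> ereal) \<Rightarrow> (real \<Rightarrow> nat \<Rightarrow> 'a::real_normed_vector) \<Rightarrow> real \<Rightarrow> nat \<Rightarrow> 'a" where
  "clamped_arc T x t j = (if T j = \<infinity> then 0 else x (clamp_time T t j) j)"

lemma
  assumes T: "jump_times T" and fin: "T j \<noteq> \<infinity>"
  shows clamp_time_mem: "(clamp_time T t j, j) \<in> jump_domain T"
    and clamp_time_mono: "s \<le> t \<Longrightarrow> clamp_time T s j \<le> clamp_time T t j"
    and clamp_time_nonexpansive: "s \<le> t \<Longrightarrow> clamp_time T t j - clamp_time T s j \<le> t - s"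
proof -
  obtain a where a: "T j = ereal a" using fin jump_times_nonneg[OF T, of j] by (cases "T j") auto
  have le: "T j \<le> T (Suc j)" by (rule jump_times_mono[OF T]) simp
  have "T (Suc j) = \<infinity> \<or> (\<exists>b. T (Suc j) = ereal b \<and> a \<le> b)"
    using le a by (cases "T (Suc j)") auto
  then consider "T (Suc j) = \<infinity>" "\<And>t. clamp_time T t j = max a t"
    | b where "T (Suc j) = ereal b" "a \<le> b" "\<And>t. clamp_time T t j = max a (min t b)"
    unfolding clamp_time_def a by (auto simp: max_def min_def)
  note cases = this
  show "(clamp_time T t j, j) \<in> jump_domain T"
    using cases by cases (auto simp: a)
  show "clamp_time T s j \<le> clamp_time T t j" if "s \<le> t"
    using cases that by cases (auto simp: max_def min_def)
  show "clamp_time T t j - clamp_time T s j \<le> t - s" if "s \<le> t"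
    using cases that by cases (auto simp: max_def min_def)
qed

lemma clamp_time_id: "(t, j) \<in> jump_domain T \<Longrightarrow> clamp_time T t j = t"
  by (simp add: clamp_time_def max_absorb2 min_absorb1)

lemma clamped_arc_eq: "(t, j) \<in> jump_domain T \<Longrightarrow> clamped_arc T x t j = x t j"
  using clamp_time_id[of t j T] by (auto simp: clamped_arc_def)

lemma clamped_arc_lipschitz:
  assumes reg: "regular_arc H M T x"
  shows "norm (clamped_arc T x s j - clamped_arc T x t j) \<le> \<bar>M\<bar> * \<bar>s - t\<bar>"
proof (cases "T j = \<infinity>")
  case False
  have T: "jump_times T" using reg by (simp add: regular_arc_def)
  have "norm (x (clamp_time T t j) j - x (clamp_time T s j) j) \<le> \<bar>M\<bar> * (t - s)" if "s \<le> t" for s t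
  proof -
    have "norm (x (clamp_time T t j) j - x (clamp_time T s j) j) \<le> M * (clamp_time T t j - clamp_time T s j)"
      using reg clamp_time_mem[OF T False] clamp_time_mono[OF T False that]
      unfolding regular_arc_def by blast
    also have "\<dots> \<le> \<bar>M\<bar> * (clamp_time T t j - clamp_time T s j)"
      using clamp_time_mono[OF T False that] by (intro mult_right_mono) auto
    also have "\<dots> \<le> \<bar>M\<bar> * (t - s)"
      using clamp_time_nonexpansive[OF T False that] by (intro mult_left_mono) auto
    finally show ?thesis .
  qed
  from this[of s t] this[of t s] show ?thesis
    using False by (cases "s \<le> t") (auto simp: clamped_arc_def norm_minus_commute)
qed (simp add: clamped_arc_def)

section \<open>Limits of regular arcs\<close>

lemma vector_derivative_upper_bound:
  assumes der: "(f has_vector_derivative w) (at t)" and h: "h > 0"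
    and le: "\<And>s. t \<le> s \<Longrightarrow> s \<le> t + h \<Longrightarrow> a \<bullet> (f s - f t) \<le> b * (s - t)"
  shows "a \<bullet> w \<le> (b::real)"
proof -
  have "((\<lambda>s. a \<bullet> f s) has_vector_derivative a \<bullet> w) (at t)"
    by (rule bounded_linear.has_vector_derivative[OF bounded_linear_inner_right der])
  then have "((\<lambda>s. (a \<bullet> f s - a \<bullet> f t) / (s - t)) \<longlongrightarrow> a \<bullet> w) (at t)"
    by (simp add: has_real_derivative_iff_has_vector_derivative[symmetric] has_field_derivative_iff)
  then have "((\<lambda>s. (a \<bullet> f s - a \<bullet> f t) / (s - t)) \<longlongrightarrow> a \<bullet> w) (at_right t)"
    by (rule tendsto_mono[rotated]) (simp add: at_within_le_at)
  moreover have "\<forall>\<^sub>F s in at_right t. (a \<bullet> f s - a \<bullet> f t) / (s - t) \<le> b"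
    unfolding eventually_at_right_field
  proof (intro exI conjI allI impI)
    show "t < t + h" using h by simp
    fix s assume "t < s" "s < t + h"
    then show "(a \<bullet> f s - a \<bullet> f t) / (s - t) \<le> b"
      using le[of s] by (simp add: inner_diff_right field_simps)
  qed
  ultimately show ?thesis
    by (rule tendsto_upperbound) simp
qed

lemma flow_map_closed:
  assumes H: "basic_assumptions H" and z: "z \<in> flow_set H"
  shows "closed (flow_map H z)"
  unfolding closed_sequential_limits
proof (intro allI impI)
  fix v l assume "(\<forall>n. v n \<in> flow_map H z) \<and> v \<longlonglongrightarrow> l"
  then show "l \<in> flow_map H z"
    using H z by (intro osc_limit[of "flow_set H" "flow_map H" z "\<lambda>_. z" v l])
      (auto simp: basic_assumptions_def)
qed

text \<open>The times in \<open>conv\<close> may vary with \<open>i\<close> because the slices of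
  the arcs move. The flow condition is first obtained at interior times of a slice, which the
  approximating slices eventually contain; the jump condition comes from the arcs' own jump
  times.\<close>

lemma limit_of_regular_arcs_is_solution:
  fixes H :: "'a::euclidean_space hybrid_system"
  assumes H: "basic_assumptions H"
    and reg: "\<And>i. regular_arc H M (S i) (x i)"
    and T: "jump_times T" and ST: "\<And>j. (\<lambda>i. S i j) \<longlonglongrightarrow> T j"
    and lip: "\<And>j s t. norm (y s j - y t j) \<le> L * \<bar>s - t\<bar>"
    and conv: "\<And>a m c. \<forall>\<^sub>F i in sequentially. (a i, m) \<in> jump_domain (S i) \<Longrightarrow> a \<longlonglongrightarrow> c \<Longrightarrow>
      (\<lambda>i. x i (a i) m) \<longlonglongrightarrow> y c m"
    and \<Gamma>: "\<And>t j. (t, j) \<in> jump_domain T \<Longrightarrow> y t j \<in> \<Gamma>"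
  shows "solution (restriction H \<Gamma>) (jump_domain T, y)"
proof -
  have clC: "closed (flow_set H)" and oscF: "outer_semicontinuous_on (flow_set H) (flow_map H)"
    and lbF: "locally_bounded_on (flow_set H) (flow_map H)"
    and Fx: "\<And>z. z \<in> flow_set H \<Longrightarrow> flow_map H z \<noteq> {} \<and> convex (flow_map H z)"
    and clD: "closed (jump_set H)" and oscG: "outer_semicontinuous_on (jump_set H) (jump_map H)"
    using H unfolding basic_assumptions_def by blast+
  have int: "\<forall>\<^sub>F i in sequentially. S i j < ereal t \<and> ereal t < S i (Suc j)"
    if "T j < ereal t" "ereal t < T (Suc j)" for t j
    using order_tendstoD(2)[OF ST that(1)] order_tendstoD(1)[OF ST that(2)] by (rule eventually_conj)
  have int_conv: "(\<lambda>i. x i t j) \<longlonglongrightarrow> y t j" if "T j < ereal t" "ereal t < T (Suc j)" for t j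
    using int[OF that] by (intro conv tendsto_const) (auto elim: eventually_mono)
  have cont: "continuous_on UNIV (\<lambda>s. y s j)" for j
  proof -
    have L: "L \<ge> 0" using order_trans[OF norm_ge_zero lip[of 0 0 1]] by simp
    have "L-lipschitz_on UNIV (\<lambda>s. y s j)"
      using lip L by (auto simp: lipschitz_on_def dist_norm)
    then show ?thesis by (rule lipschitz_on_continuous_on)
  qed
  have flow_int: "y t j \<in> flow_set H" if t: "T j < ereal t" "ereal t < T (Suc j)" for t j
  proof (rule Lim_in_closed_set[OF clC _ _ int_conv[OF t]])
    show "\<forall>\<^sub>F i in sequentially. x i t j \<in> flow_set H"
      using int[OF t]
    proof (rule eventually_mono)
      fix i assume "S i j < ereal t \<and> ereal t < S i (Suc j)"
      then show "x i t j \<in> flow_set H" using reg[of i] unfolding regular_arc_def by (auto simp: less_imp_le)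
    qed
  qed simp
  \<comment> \<open>The left end of a slice may lie outside the approximating slices; it is reached
    from the right by continuity.\<close>
  have flow: "y t j \<in> flow_set H" if t: "(t, j) \<in> jump_domain T" "ereal t < T (Suc j)" for t j
  proof -
    obtain e where e: "t < e" "ereal e < T (Suc j)" using ereal_dense2[OF t(2)] by auto
    have "((\<lambda>s. y s j) \<longlongrightarrow> y t j) (at t)" using cont[of j] by (simp add: continuous_on_def)
    then have "((\<lambda>s. y s j) \<longlongrightarrow> y t j) (at_right t)" by (rule tendsto_mono[OF at_le[OF subset_UNIV]])
    moreover have "\<forall>\<^sub>F s in at_right t. y s j \<in> flow_set H"
      unfolding eventually_at_right_field
    proof (intro exI conjI allI impI)
      show "t < e" by (rule e(1))
      fix s assume "t < s" "s < e"
      then have "ereal t < ereal s" "ereal s < ereal e" by auto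
      then have "T j < ereal s" "ereal s < T (Suc j)"
        using t(1) e(2) le_less_trans[of "T j" "ereal t" "ereal s"] less_trans[of "ereal s" "ereal e" "T (Suc j)"]
        unfolding mem_jump_domain by blast+
      then show "y s j \<in> flow_set H" by (rule flow_int)
    qed
    ultimately show ?thesis by (intro Lim_in_closed_set[OF clC]) auto
  qed
  have inclusion: "w \<in> flow_map H (y t j)"
    if t: "T j < ereal t" "ereal t < T (Suc j)" and der: "((\<lambda>s. y s j) has_vector_derivative w) (at t)" for t j w
  proof (rule ccontr)
    assume w: "w \<notin> flow_map H (y t j)"
    note yC = flow_int[OF t]
    obtain a b where ab: "a \<bullet> w < b" "\<And>v. v \<in> flow_map H (y t j) \<Longrightarrow> a \<bullet> v > b"
      using separating_hyperplane_closed_point[of "flow_map H (y t j)" w] Fx[OF yC] flow_map_closed[OF H yC] w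
      by blast
    \<comment> \<open>The hyperplane bounds the velocities from below, while both the semicontinuity
      lemma and \<open>regular_arc\<close> speak of upper bounds; hence the signs from here
      on.\<close>
    have "(- a) \<bullet> v < - b" if "v \<in> flow_map H (y t j)" for v using ab(2)[OF that] by simp
    then obtain \<delta> where \<delta>: "\<delta> > 0"
      "\<And>z v. z \<in> flow_set H \<Longrightarrow> dist z (y t j) < \<delta> \<Longrightarrow> v \<in> flow_map H z \<Longrightarrow> (- a) \<bullet> v \<le> - b"
      using osc_inner_upper_bound[OF oscF lbF yC] by metis
    obtain e where e: "t < e" "ereal e < T (Suc j)" using ereal_dense2[OF t(2)] by auto
    \<comment> \<open>Within time \<open>h\<close> an arc moves by at most \<delta> / 2, and at time
      \<open>t\<close> it is eventually within \<delta> / 2 of \<open>y t j\<close>, so it stays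
      where the velocity bound holds. The term \<open>e - t\<close> keeps \<open>t + h\<close>
      inside the slice.\<close>
    define h where "h = min (e - t) (\<delta> / (2 * (\<bar>M\<bar> + 1)))"
    have h: "h > 0" using e(1) \<delta>(1) by (simp add: h_def)
    have "\<bar>M\<bar> * h \<le> \<bar>M\<bar> * (\<delta> / (2 * (\<bar>M\<bar> + 1)))" by (intro mult_left_mono) (auto simp: h_def)
    also have "\<dots> \<le> \<delta> / 2" using \<delta>(1) by (simp add: field_simps)
    finally have Mh: "\<bar>M\<bar> * h \<le> \<delta> / 2" .
    have th: "T j < ereal (t + h)" "ereal (t + h) < T (Suc j)"
      using t(1) h e less_trans[of "T j" "ereal t" "ereal (t + h)"] le_less_trans[of "ereal (t + h)" "ereal e" "T (Suc j)"]
      by (auto simp: h_def)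
    have "(- a) \<bullet> (y s j - y t j) \<le> - b * (s - t)" if s: "t \<le> s" "s \<le> t + h" for s
    proof -
      have sj: "T j < ereal s" "ereal s < T (Suc j)"
        using t th s less_le_trans[of "T j" "ereal t" "ereal s"] le_less_trans[of "ereal s" "ereal (t + h)" "T (Suc j)"]
        by auto
      have "\<forall>\<^sub>F i in sequentially. dist (x i t j) (y t j) < \<delta> / 2"
        by (rule tendstoD[OF int_conv[OF t]]) (use \<delta>(1) in simp)
      then have ev: "\<forall>\<^sub>F i in sequentially. (- a) \<bullet> (x i s j - x i t j) \<le> - b * (s - t)"
        using int[OF t] int[OF th]
      proof eventually_elim
        case (elim i)
        have tm: "(t, j) \<in> jump_domain (S i)" and htm: "(t + h, j) \<in> jump_domain (S i)"
          using elim by (auto simp: less_imp_le)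
        have sm: "(s, j) \<in> jump_domain (S i)" using jump_domain_between[OF tm htm s] .
        have "(- a) \<bullet> v \<le> - b" if r: "t \<le> r" "r < s" "v \<in> flow_map H (x i r j)" for r v
        proof -
          have rm: "(r, j) \<in> jump_domain (S i)" using jump_domain_between[OF tm sm] r by simp
          have "ereal r < ereal (t + h)" using r s by simp
          then have "ereal r < S i (Suc j)" using elim less_trans by blast
          then have "x i r j \<in> flow_set H" using reg[of i] rm unfolding regular_arc_def by blast
          moreover have "norm (x i r j - x i t j) \<le> M * (r - t)"
            using reg[of i] rm tm r(1) unfolding regular_arc_def by blast
          then have "dist (x i r j) (x i t j) \<le> \<delta> / 2"
          proof -
            have "M * (r - t) \<le> \<bar>M\<bar> * (r - t)" using r by (intro mult_right_mono) auto
            also have "\<dots> \<le> \<bar>M\<bar> * h" using r s by (intro mult_left_mono) auto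
            finally show ?thesis using Mh \<open>norm (x i r j - x i t j) \<le> M * (r - t)\<close> by (simp add: dist_norm)
          qed
          then have "dist (x i r j) (y t j) < \<delta>"
            using elim dist_triangle[of "x i r j" "y t j" "x i t j"] by simp
          ultimately show ?thesis using \<delta>(2) r(3) by blast
        qed
        then show ?case using reg[of i] tm sm s(1) unfolding regular_arc_def by blast
      qed
      have "(\<lambda>i. (- a) \<bullet> (x i s j - x i t j)) \<longlonglongrightarrow> (- a) \<bullet> (y s j - y t j)"
        by (intro tendsto_intros int_conv t sj)
      then show ?thesis by (rule tendsto_upperbound[OF _ ev]) simp
    qed
    then have "(- a) \<bullet> w \<le> - b" by (rule vector_derivative_upper_bound[OF der h])
    then show False using ab(1) by simp
  qed
  show ?thesis
    unfolding solution_def hybrid_arc_def prod.case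
  proof (intro conjI allI impI)
    show "hybrid_time_domain (jump_domain T)" by (rule hybrid_time_domain_jump_domain[OF T])
    show "locally_absolutely_continuous_on (time_slice (jump_domain T) j) (\<lambda>t. y t j)" for j
      unfolding locally_absolutely_continuous_on_def
      using absolutely_continuous_on_lipschitz[of _ _ "\<lambda>t. y t j" L] lip by blast
    show "AE t in lebesgue. t \<in> time_slice (jump_domain T) j \<longrightarrow>
           (\<exists>v\<in>flow_map (restriction H \<Gamma>) (y t j).
              ((\<lambda>s. y s j) has_vector_derivative v) (at t within time_slice (jump_domain T) j))" for j
    proof -
      obtain N where N: "negligible N" "\<And>t. t \<notin> N \<Longrightarrow> (\<lambda>s. y s j) differentiable at t"
        using lipschitz_differentiable_ae[of "\<lambda>s. y s j" L] lip by blast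
      \<comment> \<open>The ends of the slice are removed because \<open>inclusion\<close> needs
        interior times. An infinite end is sent to 0, which just removes one more point.\<close>
      have "negligible (insert (real_of_ereal (T j)) (insert (real_of_ereal (T (Suc j))) N))"
        using N(1) by simp
      then have "AE t in lebesgue. t \<notin> insert (real_of_ereal (T j)) (insert (real_of_ereal (T (Suc j))) N)"
        unfolding negligible_iff_null_sets by (rule AE_not_in)
      then show ?thesis
      proof (rule eventually_mono, intro impI)
        fix t assume t: "t \<notin> insert (real_of_ereal (T j)) (insert (real_of_ereal (T (Suc j))) N)"
          "t \<in> time_slice (jump_domain T) j"
        then have "T j \<le> ereal t" "T j \<noteq> ereal t" "ereal t \<le> T (Suc j)" "T (Suc j) \<noteq> ereal t"
          by (auto simp: time_slice_jump_domain)
        then have tt: "T j < ereal t" "ereal t < T (Suc j)" by (auto simp: less_le)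
        have "((\<lambda>s. y s j) has_vector_derivative vector_derivative (\<lambda>s. y s j) (at t)) (at t)"
          using N(2)[of t] t(1) by (simp add: vector_derivative_works)
        then show "\<exists>v\<in>flow_map (restriction H \<Gamma>) (y t j).
              ((\<lambda>s. y s j) has_vector_derivative v) (at t within time_slice (jump_domain T) j)"
          using inclusion[OF tt] has_vector_derivative_at_within[of _ _ t] unfolding restriction_def by fastforce
      qed
    qed
    show "\<forall>t\<in>time_slice (jump_domain T) j. (\<exists>s\<in>time_slice (jump_domain T) j. t < s) \<longrightarrow>
        y t j \<in> flow_set (restriction H \<Gamma>)" for j
    proof (intro ballI impI)
      fix t assume t: "t \<in> time_slice (jump_domain T) j" and "\<exists>s\<in>time_slice (jump_domain T) j. t < s"
      then obtain s where s: "ereal t < ereal s" "ereal s \<le> T (Suc j)" by (auto simp: time_slice_jump_domain)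
      have tm: "(t, j) \<in> jump_domain T" using t by (simp add: time_slice_def)
      show "y t j \<in> flow_set (restriction H \<Gamma>)"
        using flow[OF tm less_le_trans[OF s]] \<Gamma>[OF tm] by (simp add: restriction_def)
    qed
    fix t j assume m: "(t, j) \<in> jump_domain T \<and> (t, Suc j) \<in> jump_domain T"
    then have Tt: "T (Suc j) = ereal t" by (simp add: antisym)
    \<comment> \<open>A jump of the limit at \<open>t\<close> forces
      \<open>T (Suc j) = ereal t\<close>, so the jump times \<open>s i\<close> tend to
      \<open>t\<close>, and the values on both sides of the jump converge along them.\<close>
    define s where "s i = real_of_ereal (S i (Suc j))" for i
    have fin: "\<forall>\<^sub>F i in sequentially. S i (Suc j) = ereal (s i)"
    proof -
      have "\<forall>\<^sub>F i in sequentially. S i (Suc j) < \<infinity>"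
        using order_tendstoD(2)[OF ST, of "Suc j" \<infinity>] Tt by simp
      then show ?thesis
      proof (rule eventually_mono)
        fix i assume "S i (Suc j) < \<infinity>"
        moreover have "0 \<le> S i (Suc j)" using reg[of i] by (simp add: regular_arc_def jump_times_nonneg)
        ultimately show "S i (Suc j) = ereal (s i)" by (cases "S i (Suc j)") (auto simp: s_def)
      qed
    qed
    have st: "s \<longlonglongrightarrow> t"
      unfolding s_def using ST[of "Suc j"] by (intro lim_real_of_ereal) (simp add: Tt)
    have mem: "\<forall>\<^sub>F i in sequentially. (s i, j) \<in> jump_domain (S i) \<and> (s i, Suc j) \<in> jump_domain (S i)"
      using fin
    proof (rule eventually_mono)
      fix i assume "S i (Suc j) = ereal (s i)"
      moreover have "S i j \<le> S i (Suc j)" "S i (Suc j) \<le> S i (Suc (Suc j))"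
        using reg[of i] by (auto simp: regular_arc_def intro: jump_times_mono)
      ultimately show "(s i, j) \<in> jump_domain (S i) \<and> (s i, Suc j) \<in> jump_domain (S i)" by simp
    qed
    have c1: "(\<lambda>i. x i (s i) j) \<longlonglongrightarrow> y t j" and c2: "(\<lambda>i. x i (s i) (Suc j)) \<longlonglongrightarrow> y t (Suc j)"
      using mem st by (auto intro!: conv elim: eventually_mono)
    have jmp: "\<forall>\<^sub>F i in sequentially. x i (s i) j \<in> jump_set H \<and> x i (s i) (Suc j) \<in> jump_map H (x i (s i) j)"
      using mem by (rule eventually_mono) (use reg in \<open>unfold regular_arc_def, blast\<close>)
    have yD: "y t j \<in> jump_set H"
      by (rule Lim_in_closed_set[OF clD _ _ c1]) (use jmp in \<open>auto elim: eventually_mono\<close>)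
    then show "y t j \<in> jump_set (restriction H \<Gamma>)"
      using \<Gamma> m by (simp add: restriction_def)
    show "y t (Suc j) \<in> jump_map (restriction H \<Gamma>) (y t j)"
      using osc_limit[OF oscG yD jmp c1 c2] by (simp add: restriction_def)
  qed
qed

text \<open>Graphical convergence in two halves: limits of points of the arcs lie on the limit arc,
  and every point of the limit arc is approached. The further subsequence \<open>u\<close> serves
  the ends of excursions, whose times converge only after another selection. \<Gamma> is left open
  because the approximation is what will show that the limit lies in it.\<close>

lemma regular_arcs_subsequence:
  fixes H :: "'a::euclidean_space hybrid_system" and S :: "nat \<Rightarrow> nat \<Rightarrow> ereal"
  assumes H: "basic_assumptions H" and reg: "\<And>i. regular_arc H M (S i) (x i)"
    and bd: "\<And>i t j. (t, j) \<in> jump_domain (S i) \<Longrightarrow> norm (x i t j) \<le> B"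
  obtains r T y where "strict_mono r" "jump_times T"
    "\<forall>u a m c. strict_mono u \<and> (\<forall>\<^sub>F i in sequentially. (a i, m) \<in> jump_domain (S (r (u i)))) \<and> a \<longlonglongrightarrow> c \<longrightarrow>
      (c, m) \<in> jump_domain T \<and> (\<lambda>i. x (r (u i)) (a i) m) \<longlonglongrightarrow> y c m"
    "\<forall>c m. (c, m) \<in> jump_domain T \<longrightarrow>
      (\<exists>a. a \<longlonglongrightarrow> c \<and> (\<forall>\<^sub>F i in sequentially. (a i, m) \<in> jump_domain (S (r i))))"
    "\<forall>\<Gamma>. (\<forall>t j. (t, j) \<in> jump_domain T \<longrightarrow> y t j \<in> \<Gamma>) \<longrightarrow> solution (restriction H \<Gamma>) (jump_domain T, y)"
proof -
  have jt: "jump_times (S i)" for i using reg[of i] by (simp add: regular_arc_def)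
  obtain r0 T where r0: "strict_mono r0" and ST0: "\<forall>j. (\<lambda>i. S (r0 i) j) \<longlonglongrightarrow> T j"
    by (rule ereal_diagonal_subsequence[of S])
  have B0: "0 \<le> B"
  proof -
    have "(0, 0) \<in> jump_domain (S 0)"
      using jt[of 0] jump_times_nonneg[OF jt, of 0 1] by (simp add: jump_times_def zero_ereal_def)
    then show ?thesis using bd order_trans[OF norm_ge_zero] by blast
  qed
  have cbd: "norm (clamped_arc (S i) (x i) t j) \<le> B" for i t j
    using bd[OF clamp_time_mem[OF jt]] B0 by (cases "S i j = \<infinity>") (auto simp: clamped_arc_def simp del: mem_jump_domain)
  have "countable (\<rat> \<times> (UNIV :: nat set))" by (simp add: countable_rat)
  then obtain k where k: "strict_mono k" "\<And>p. p \<in> \<rat> \<times> (UNIV :: nat set) \<Longrightarrow>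
      \<exists>l. (\<lambda>n. clamped_arc (S (r0 (k n))) (x (r0 (k n))) (fst p) (snd p)) \<longlonglongrightarrow> l"
    using function_convergent_subsequence[of "\<rat> \<times> (UNIV :: nat set)"
        "\<lambda>n p. clamped_arc (S (r0 n)) (x (r0 n)) (fst p) (snd p)" B] cbd by blast
  define r where "r = r0 \<circ> k"
  have r: "strict_mono r" unfolding r_def by (rule strict_mono_o[OF r0 k(1)])
  have ST: "(\<lambda>i. S (r i) j) \<longlonglongrightarrow> T j" for j
    using LIMSEQ_subseq_LIMSEQ[OF ST0[rule_format, of j] k(1)] by (simp add: r_def o_def)
  have T: "jump_times T"
  proof -
    have "(\<lambda>i. S (r i) 0) \<longlonglongrightarrow> 0" using jt by (simp add: jump_times_def)
    then have "T 0 = 0" by (rule LIMSEQ_unique[OF ST[of 0]])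
    moreover have "T j \<le> T (Suc j)" for j
      using LIMSEQ_le[OF ST[of j] ST[of "Suc j"]] jump_times_mono[OF jt, of j "Suc j"] by simp
    ultimately show ?thesis by (simp add: jump_times_def mono_iff_le_Suc)
  qed
  define Z where "Z i j t = clamped_arc (S (r i)) (x (r i)) t j" for i j t
  have lipZ: "norm (Z i j s - Z i j t) \<le> \<bar>M\<bar> * \<bar>s - t\<bar>" for i j s t
    unfolding Z_def by (rule clamped_arc_lipschitz[OF reg])
  have "convergent (\<lambda>i. Z i j t)" for j t
  proof (rule equi_lipschitz_convergent[OF lipZ])
    fix q :: real assume "q \<in> \<rat>"
    then show "convergent (\<lambda>i. Z i j q)"
      using k(2)[of "(q, j)"] by (simp add: Z_def r_def convergent_def)
  qed
  then have Zy: "(\<lambda>i. Z i j t) \<longlonglongrightarrow> lim (\<lambda>i. Z i j t)" for j t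
    by (simp only: convergent_LIMSEQ_iff)
  define y where "y t j = lim (\<lambda>i. Z i j t)" for t j
  note Zy = Zy[folded y_def]
  have lipy: "norm (y s j - y t j) \<le> \<bar>M\<bar> * \<bar>s - t\<bar>" for j s t
    by (rule LIMSEQ_le_const2[OF tendsto_norm[OF tendsto_diff[OF Zy Zy]]]) (use lipZ in blast)
  have conv: "(c, m) \<in> jump_domain T \<and> (\<lambda>i. x (r (u i)) (a i) m) \<longlonglongrightarrow> y c m"
    if u: "strict_mono u" and ev: "\<forall>\<^sub>F i in sequentially. (a i, m) \<in> jump_domain (S (r (u i)))"
      and ac: "a \<longlonglongrightarrow> c" for u a m c
  proof
    have STu: "(\<lambda>i. S (r (u i)) j) \<longlonglongrightarrow> T j" for j
      using LIMSEQ_subseq_LIMSEQ[OF ST u] by (simp add: o_def)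
    have eac: "(\<lambda>i. ereal (a i)) \<longlonglongrightarrow> ereal c" using ac by simp
    have "T m \<le> ereal c"
      by (rule tendsto_le[OF sequentially_bot eac STu]) (use ev in \<open>auto elim: eventually_mono\<close>)
    moreover have "ereal c \<le> T (Suc m)"
      by (rule tendsto_le[OF sequentially_bot STu eac]) (use ev in \<open>auto elim: eventually_mono\<close>)
    ultimately show "(c, m) \<in> jump_domain T" by simp
    \<comment> \<open>By the common Lipschitz constant this is the most it costs to move the time
      from \<open>a i\<close> to the fixed \<open>c\<close>.\<close>
    have "(\<lambda>i. \<bar>M\<bar> * \<bar>a i - c\<bar>) \<longlonglongrightarrow> \<bar>M\<bar> * \<bar>c - c\<bar>" by (intro tendsto_intros ac)
    then have "(\<lambda>i. \<bar>M\<bar> * \<bar>a i - c\<bar>) \<longlonglongrightarrow> 0" by simp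
    then have "(\<lambda>i. Z (u i) m (a i) - Z (u i) m c) \<longlonglongrightarrow> 0"
      by (rule Lim_null_comparison[rotated]) (use lipZ in simp)
    moreover have "(\<lambda>i. Z (u i) m c) \<longlonglongrightarrow> y c m"
      using LIMSEQ_subseq_LIMSEQ[OF Zy u] by (simp add: o_def)
    ultimately have "(\<lambda>i. (Z (u i) m (a i) - Z (u i) m c) + Z (u i) m c) \<longlonglongrightarrow> 0 + y c m"
      by (rule tendsto_add)
    then have "(\<lambda>i. Z (u i) m (a i)) \<longlonglongrightarrow> y c m" by simp
    moreover have "\<forall>\<^sub>F i in sequentially. Z (u i) m (a i) = x (r (u i)) (a i) m"
      using ev by (rule eventually_mono) (simp add: Z_def clamped_arc_eq del: mem_jump_domain)
    ultimately show "(\<lambda>i. x (r (u i)) (a i) m) \<longlonglongrightarrow> y c m" by (rule Lim_transform_eventually)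
  qed
  show ?thesis
  proof (rule that[OF r T])
    show "\<forall>u a m c. strict_mono u \<and> (\<forall>\<^sub>F i in sequentially. (a i, m) \<in> jump_domain (S (r (u i)))) \<and> a \<longlonglongrightarrow> c \<longrightarrow>
      (c, m) \<in> jump_domain T \<and> (\<lambda>i. x (r (u i)) (a i) m) \<longlonglongrightarrow> y c m"
      using conv by blast
    show "\<forall>c m. (c, m) \<in> jump_domain T \<longrightarrow>
      (\<exists>a. a \<longlonglongrightarrow> c \<and> (\<forall>\<^sub>F i in sequentially. (a i, m) \<in> jump_domain (S (r i))))"
    proof (intro allI impI exI conjI)
      fix c m assume cm: "(c, m) \<in> jump_domain T"
      \<comment> \<open>The witness is \<open>c\<close> clamped to the slices of the arcs:
        \<open>max\<close> and \<open>min\<close> are continuous on the extended reals, and clamping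
        fixes \<open>c\<close> in the limit slice.\<close>
      have "(\<lambda>i. max (S (r i) m) (min (ereal c) (S (r i) (Suc m)))) \<longlonglongrightarrow> max (T m) (min (ereal c) (T (Suc m)))"
        by (intro tendsto_max tendsto_min tendsto_const ST)
      also have "max (T m) (min (ereal c) (T (Suc m))) = ereal c"
        using cm by (simp add: max_absorb2 min_absorb1)
      finally show "(\<lambda>i. clamp_time (S (r i)) c m) \<longlonglongrightarrow> c"
        unfolding clamp_time_def by (rule lim_real_of_ereal)
      have "T m < \<infinity>" using cm le_less_trans[of "T m" "ereal c" \<infinity>] by simp
      then have "\<forall>\<^sub>F i in sequentially. S (r i) m < \<infinity>" by (rule order_tendstoD(2)[OF ST])
      then show "\<forall>\<^sub>F i in sequentially. (clamp_time (S (r i)) c m, m) \<in> jump_domain (S (r i))"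
        by (rule eventually_mono) (intro clamp_time_mem jt, simp)
    qed
    show "\<forall>\<Gamma>. (\<forall>t j. (t, j) \<in> jump_domain T \<longrightarrow> y t j \<in> \<Gamma>) \<longrightarrow> solution (restriction H \<Gamma>) (jump_domain T, y)"
    proof (intro allI impI)
      fix \<Gamma> assume \<Gamma>: "\<forall>t j. (t, j) \<in> jump_domain T \<longrightarrow> y t j \<in> \<Gamma>"
      show "solution (restriction H \<Gamma>) (jump_domain T, y)"
      proof (rule limit_of_regular_arcs_is_solution[OF H reg T ST lipy])
        show "(\<lambda>i. x (r i) (a i) m) \<longlonglongrightarrow> y c m"
          if "\<forall>\<^sub>F i in sequentially. (a i, m) \<in> jump_domain (S (r i))" "a \<longlonglongrightarrow> c" for a m c
          using conv[OF strict_mono_id] that by simp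
      qed (use \<Gamma> in blast)
    qed
  qed
qed

section \<open>Convergence of bounded solutions\<close>

text \<open>A larger index forces a time at least as large, so two points never differ in opposite
  directions. This makes the end of an excursion a point of the arc shifted to its start.\<close>

lemma jump_domain_chain:
  assumes T: "jump_times T" and m: "(t, j) \<in> jump_domain T" "(s, k) \<in> jump_domain T"
    and le: "t + real j \<le> s + real k"
  shows "t \<le> s" "j \<le> k"
proof -
  note ord = hybrid_time_domain_ordered(2)[OF hybrid_time_domain_jump_domain[OF T]]
  have "t \<le> s \<and> j \<le> k"
    using ord[OF m] ord[OF m(2) m(1)] le by (cases j k rule: linorder_cases) auto
  then show "t \<le> s" "j \<le> k" by auto
qed

lemma converges_to_iff:
  "converges_to (E, x) \<Gamma> \<longleftrightarrow>
     (\<forall>e>0. \<exists>N. \<forall>t j. (t, j) \<in> E \<and> t + real j \<ge> N \<longrightarrow> infdist (x t j) \<Gamma> < e)"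
proof -
  have "(\<forall>\<^sub>F p in inf (filtercomap (\<lambda>(t, j). t + real j) at_top) (principal E).
         dist (case p of (t, j) \<Rightarrow> infdist (x t j) \<Gamma>) 0 < e) \<longleftrightarrow>
       (\<exists>N. \<forall>t j. (t, j) \<in> E \<and> t + real j \<ge> N \<longrightarrow> infdist (x t j) \<Gamma> < e)" for e
    unfolding eventually_inf_principal eventually_filtercomap_at_top_linorder
    by (simp add: dist_real_def infdist_nonneg) blast
  then show ?thesis unfolding converges_to_def tendsto_iff by simp
qed

text \<open>The starting points run off to infinity, so convergence to \<Gamma> puts the whole limit
  arc into \<Gamma>; this is how properties of the restricted system come to bear on
  \<open>x\<close>. The lag 1 in \<open>p\<close> leaves room for starting points chosen within 1 of
  a supremum.\<close>

lemma shifted_arcs_limit: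
  fixes H :: "'a::euclidean_space hybrid_system"
  assumes H: "basic_assumptions H" and reg: "regular_arc H M T x"
    and bd: "\<And>t j. (t, j) \<in> jump_domain T \<Longrightarrow> norm (x t j) \<le> B"
    and \<Gamma>: "closed \<Gamma>" "\<Gamma> \<noteq> {}" and conv: "converges_to (jump_domain T, x) \<Gamma>"
    and p: "\<And>i. (\<tau> i, k i) \<in> jump_domain T" "\<And>i. real i - 1 \<le> \<tau> i + real (k i)"
  obtains r T' y where "strict_mono r" "jump_times T'" "maximal_solution (restriction H \<Gamma>) (jump_domain T', y)"
    "\<forall>u a m c. strict_mono u \<and> (\<forall>\<^sub>F i in sequentially. 0 \<le> a i \<and> (\<tau> (r (u i)) + a i, k (r (u i)) + m) \<in> jump_domain T) \<and>
      a \<longlonglongrightarrow> c \<longrightarrow>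
      (c, m) \<in> jump_domain T' \<and> (\<lambda>i. x (\<tau> (r (u i)) + a i) (k (r (u i)) + m)) \<longlonglongrightarrow> y c m"
    "\<forall>c m. (c, m) \<in> jump_domain T' \<longrightarrow>
      (\<exists>a. a \<longlonglongrightarrow> c \<and> (\<forall>\<^sub>F i in sequentially. 0 \<le> a i \<and> (\<tau> (r i) + a i, k (r i) + m) \<in> jump_domain T) \<and>
        (\<lambda>i. x (\<tau> (r i) + a i) (k (r i) + m)) \<longlonglongrightarrow> y c m)"
proof -
  have T: "jump_times T" using reg by (simp add: regular_arc_def)
  define S where "S i = shift_times T (\<tau> i) (k i)" for i
  define z where "z i = (\<lambda>t j. x (\<tau> i + t) (k i + j))" for i
  have mem: "(t, j) \<in> jump_domain (S i) \<longleftrightarrow> 0 \<le> t \<and> (\<tau> i + t, k i + j) \<in> jump_domain T" for t j i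
    unfolding S_def by (rule mem_shift_times[OF T p(1)])
  have regz: "regular_arc H M (S i) (z i)" for i
    unfolding S_def z_def by (rule regular_arc_shift[OF reg p(1)])
  have bdz: "norm (z i t j) \<le> B" if "(t, j) \<in> jump_domain (S i)" for i t j
    using that bd unfolding mem z_def by blast
  obtain r T' y where r: "strict_mono r" and T': "jump_times T'"
    and CC: "\<forall>u a m c. strict_mono u \<and> (\<forall>\<^sub>F i in sequentially. (a i, m) \<in> jump_domain (S (r (u i)))) \<and> a \<longlonglongrightarrow> c \<longrightarrow>
      (c, m) \<in> jump_domain T' \<and> (\<lambda>i. z (r (u i)) (a i) m) \<longlonglongrightarrow> y c m"
    and AP: "\<forall>c m. (c, m) \<in> jump_domain T' \<longrightarrow>
      (\<exists>a. a \<longlonglongrightarrow> c \<and> (\<forall>\<^sub>F i in sequentially. (a i, m) \<in> jump_domain (S (r i))))"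
    and sol: "\<forall>\<Gamma>. (\<forall>t j. (t, j) \<in> jump_domain T' \<longrightarrow> y t j \<in> \<Gamma>) \<longrightarrow>
      solution (restriction H \<Gamma>) (jump_domain T', y)"
    by (rule regular_arcs_subsequence[OF H regz bdz])
  have AP': "\<exists>a. a \<longlonglongrightarrow> c \<and> (\<forall>\<^sub>F i in sequentially. (a i, m) \<in> jump_domain (S (r i))) \<and>
        (\<lambda>i. z (r i) (a i) m) \<longlonglongrightarrow> y c m" if cm: "(c, m) \<in> jump_domain T'" for c m
  proof -
    obtain a where a: "a \<longlonglongrightarrow> c" "\<forall>\<^sub>F i in sequentially. (a i, m) \<in> jump_domain (S (r i))"
      using AP cm by blast
    then have "(\<lambda>i. z (r i) (a i) m) \<longlonglongrightarrow> y c m"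
      using CC[rule_format, of id a m c] strict_mono_id[where 'a=nat] by simp
    then show ?thesis using a by blast
  qed
  have "y c m \<in> \<Gamma>" if cm: "(c, m) \<in> jump_domain T'" for c m
  proof -
    obtain a where a: "\<forall>\<^sub>F i in sequentially. (a i, m) \<in> jump_domain (S (r i))"
        "(\<lambda>i. z (r i) (a i) m) \<longlonglongrightarrow> y c m"
      using AP'[OF cm] by blast
    have "infdist (y c m) \<Gamma> \<le> e" if e: "e > 0" for e
    proof -
      obtain N where N: "\<And>t j. (t, j) \<in> jump_domain T \<Longrightarrow> t + real j \<ge> N \<Longrightarrow> infdist (x t j) \<Gamma> < e"
        using conv e unfolding converges_to_iff by blast
      have "\<forall>\<^sub>F i in sequentially. N + 1 \<le> real i"
        using filterlim_real_sequentially by (simp add: filterlim_at_top)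
      with a(1) have "\<forall>\<^sub>F i in sequentially. infdist (z (r i) (a i) m) \<Gamma> \<le> e"
      proof eventually_elim
        case (elim i)
        \<comment> \<open>A subsequence runs off at least as fast, and moving on by
          \<open>a i\<close> and \<open>m\<close> only increases the hybrid time; the 1 in
          \<open>N + 1\<close> absorbs the lag in \<open>p\<close>.\<close>
        have "i \<le> r i" using seq_suble[OF r] .
        then have "N \<le> (\<tau> (r i) + a i) + real (k (r i) + m)"
          using elim p(2)[of "r i"] unfolding mem by simp
        then show ?case using N[of "\<tau> (r i) + a i" "k (r i) + m"] elim(1) unfolding mem z_def by (simp add: less_imp_le)
      qed
      then show ?thesis
        by (rule tendsto_upperbound[OF tendsto_infdist[OF a(2)]]) simp
    qed
    then have "infdist (y c m) \<Gamma> = 0"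
      using infdist_nonneg[of "y c m" \<Gamma>] by (metis dense_ge antisym)
    then show ?thesis using in_closed_iff_infdist_zero[OF \<Gamma>] by simp
  qed
  then have "solution (restriction H \<Gamma>) (jump_domain T', y)" using sol by blast
  then have max: "maximal_solution (restriction H \<Gamma>) (jump_domain T', y)"
    by (rule maximal_solution_jump_domain[OF T'])
  show ?thesis
    by (rule that[OF r T' max]) (use CC AP' in \<open>unfold mem z_def, blast\<close>)+
qed

lemma bounded_solution_converges:
  fixes H :: "'a::euclidean_space hybrid_system"
  assumes H: "basic_assumptions H" and sub: "\<Gamma>1 \<subseteq> \<Gamma>2" and ne: "\<Gamma>1 \<noteq> {}" and cl: "closed \<Gamma>2"
    and gas: "globally_asymptotically_stable (restriction H \<Gamma>2) \<Gamma>1"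
    and T: "jump_times T" and sol: "solution H (jump_domain T, x)"
    and bd: "bounded_arc (jump_domain T, x)" and conv: "converges_to (jump_domain T, x) \<Gamma>2"
  shows "converges_to (jump_domain T, x) \<Gamma>1"
proof (rule ccontr)
  assume "\<not> converges_to (jump_domain T, x) \<Gamma>1"
  then obtain e where e: "e > 0"
    and far: "\<And>N. \<exists>t j. (t, j) \<in> jump_domain T \<and> t + real j \<ge> N \<and> infdist (x t j) \<Gamma>1 \<ge> e"
    unfolding converges_to_iff not_all not_ex not_imp not_less by blast
  have ne2: "\<Gamma>2 \<noteq> {}" using ne sub by blast
  have rng: "x t j \<in> arc_range (jump_domain T, x)" if "(t, j) \<in> jump_domain T" for t j and T and x :: "real \<Rightarrow> nat \<Rightarrow> 'a"
    using that unfolding arc_range_def by force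
  obtain B where B: "\<And>t j. (t, j) \<in> jump_domain T \<Longrightarrow> norm (x t j) \<le> B"
    using bd rng unfolding bounded_arc_def bounded_iff by blast
  obtain M where reg: "regular_arc H M T x"
  proof (rule regular_arc_of_bounded_solution[OF H T sol, of "cball 0 B"])
    show "\<And>t j. (t, j) \<in> jump_domain T \<Longrightarrow> x t j \<in> cball 0 B" using B by (simp del: mem_jump_domain)
  qed simp_all
  \<comment> \<open>Closeness to \<Gamma>1 will mean distance below \<delta> / 2: the start of a
    limit then has distance at most \<delta> / 2, still below \<delta>.\<close>
  obtain \<delta> where \<delta>: "\<delta> > 0" "reach (restriction H \<Gamma>2) (nbhd \<delta> \<Gamma>1) \<subseteq> nbhd e \<Gamma>1"
    using gas e unfolding globally_asymptotically_stable_def stable_def by blast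
  have attr: "\<exists>c m. (c, m) \<in> jump_domain S \<and> N \<le> c + real m \<and> infdist (y c m) \<Gamma>1 < \<delta> / 2"
    if S: "jump_times S" and y: "maximal_solution (restriction H \<Gamma>2) (jump_domain S, y)" for S y N
  proof -
    have "y 0 0 \<in> basin (restriction H \<Gamma>2) \<Gamma>1"
      using gas unfolding globally_asymptotically_stable_def globally_attractive_def by simp
    moreover have "(jump_domain S, y) \<in> solutions_from (restriction H \<Gamma>2) {y 0 0}"
      using y by (simp add: solutions_from_def)
    ultimately have "converges_to (jump_domain S, y) \<Gamma>1"
      using complete_arc_jump_domain[OF S] unfolding basin_def by blast
    then obtain N' where "\<And>t j. (t, j) \<in> jump_domain S \<Longrightarrow> t + real j \<ge> N' \<Longrightarrow> infdist (y t j) \<Gamma>1 < \<delta> / 2"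
      unfolding converges_to_iff using half_gt_zero[OF \<delta>(1)] by blast
    moreover obtain c m where "(c, m) \<in> jump_domain S" "max N N' \<le> c + real m"
      using jump_domain_unbounded[OF S] by blast
    ultimately show ?thesis by (metis max.bounded_iff)
  qed
  have near: "\<exists>t j. (t, j) \<in> jump_domain T \<and> t + real j \<ge> N \<and> infdist (x t j) \<Gamma>1 < \<delta> / 2" for N
  proof -
    have "\<forall>i. \<exists>p. p \<in> jump_domain T \<and> real i - 1 \<le> fst p + real (snd p)"
      using jump_domain_unbounded[OF T] by fastforce
    then obtain p where p: "\<And>i. p i \<in> jump_domain T" "\<And>i. real i - 1 \<le> fst (p i) + real (snd (p i))"
      by metis
    define \<tau> k where "\<tau> i = fst (p i)" and "k i = snd (p i)" for i
    have pk: "(\<tau> i, k i) \<in> jump_domain T" "real i - 1 \<le> \<tau> i + real (k i)" for i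
      using p[of i] by (simp_all add: \<tau>_def k_def del: mem_jump_domain)
    obtain r T' y where r: "strict_mono r" and T': "jump_times T'"
      and y: "maximal_solution (restriction H \<Gamma>2) (jump_domain T', y)"
      and AP: "\<forall>c m. (c, m) \<in> jump_domain T' \<longrightarrow>
      (\<exists>a. a \<longlonglongrightarrow> c \<and> (\<forall>\<^sub>F i in sequentially. 0 \<le> a i \<and> (\<tau> (r i) + a i, k (r i) + m) \<in> jump_domain T) \<and>
        (\<lambda>i. x (\<tau> (r i) + a i) (k (r i) + m)) \<longlonglongrightarrow> y c m)"
      by (rule shifted_arcs_limit[OF H reg B cl ne2 conv pk])
    obtain c m where cm: "(c, m) \<in> jump_domain T'" "infdist (y c m) \<Gamma>1 < \<delta> / 2"
      using attr[OF T' y] by blast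
    obtain a where a: "\<forall>\<^sub>F i in sequentially. 0 \<le> a i \<and> (\<tau> (r i) + a i, k (r i) + m) \<in> jump_domain T"
        "(\<lambda>i. x (\<tau> (r i) + a i) (k (r i) + m)) \<longlonglongrightarrow> y c m"
      using AP cm(1) by blast
    have "\<forall>\<^sub>F i in sequentially. infdist (x (\<tau> (r i) + a i) (k (r i) + m)) \<Gamma>1 < \<delta> / 2"
      by (rule order_tendstoD(2)[OF tendsto_infdist[OF a(2)] cm(2)])
    moreover have "\<forall>\<^sub>F i in sequentially. N + 1 \<le> real i"
      using filterlim_real_sequentially by (simp add: filterlim_at_top)
    ultimately have "\<forall>\<^sub>F i in sequentially. (\<tau> (r i) + a i, k (r i) + m) \<in> jump_domain T \<and>
        (\<tau> (r i) + a i) + real (k (r i) + m) \<ge> N \<and> infdist (x (\<tau> (r i) + a i) (k (r i) + m)) \<Gamma>1 < \<delta> / 2"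
      using a(1)
    proof eventually_elim
      case (elim i)
      have "i \<le> r i" using seq_suble[OF r] .
      then have "N \<le> (\<tau> (r i) + a i) + real (k (r i) + m)" using elim pk(2)[of "r i"] by simp
      then show ?case using elim by blast
    qed
    from eventually_happens'[OF sequentially_bot this] show ?thesis by blast
  qed
  \<comment> \<open>Excursions: from a point close to \<open>\<Gamma>1\<close> the arc moves far away from \<open>\<Gamma>1\<close>, and from one time unit
    after the start on it is not close to \<open>\<Gamma>1\<close> before that.\<close>
  define Q where "Q n p q \<longleftrightarrow> p \<in> jump_domain T \<and> q \<in> jump_domain T \<and> real n - 1 \<le> fst p + real (snd p) \<and>
      fst p + real (snd p) \<le> fst q + real (snd q) \<and>
      infdist (x (fst p) (snd p)) \<Gamma>1 < \<delta> / 2 \<and> e \<le> infdist (x (fst q) (snd q)) \<Gamma>1 \<and>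
      (\<forall>t j. (t, j) \<in> jump_domain T \<and> fst p + real (snd p) + 1 \<le> t + real j \<and> t + real j \<le> fst q + real (snd q) \<longrightarrow>
         \<delta> / 2 \<le> infdist (x t j) \<Gamma>1)" for n :: nat and p q
  have "\<exists>p q. Q n p q" for n
  proof -
    obtain t1 j1 where 1: "(t1, j1) \<in> jump_domain T" "t1 + real j1 \<ge> real n" "infdist (x t1 j1) \<Gamma>1 < \<delta> / 2"
      using near by blast
    obtain t2 j2 where 2: "(t2, j2) \<in> jump_domain T" "t2 + real j2 \<ge> t1 + real j1" "infdist (x t2 j2) \<Gamma>1 \<ge> e"
      using far by blast
    define V where "V = {t + real j |t j. (t, j) \<in> jump_domain T \<and> t + real j \<le> t2 + real j2 \<and> infdist (x t j) \<Gamma>1 < \<delta> / 2}"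
    have V1: "t1 + real j1 \<in> V" unfolding V_def using 1 2 by blast
    have bddV: "bdd_above V" unfolding V_def by (rule bdd_aboveI[of _ "t2 + real j2"]) blast
    \<comment> \<open>The supremum of the close times need not be attained. A close time within 1 of
      it suffices, which is the origin of the one time unit in \<open>Q\<close>.\<close>
    obtain v where v: "v \<in> V" "Sup V - 1 < v" using less_cSupD[of V "Sup V - 1"] V1 by auto
    obtain t3 j3 where 3: "v = t3 + real j3" "(t3, j3) \<in> jump_domain T" "t3 + real j3 \<le> t2 + real j2"
        "infdist (x t3 j3) \<Gamma>1 < \<delta> / 2"
      using v(1) unfolding V_def by blast
    have "real n \<le> Sup V" using cSup_upper[OF V1 bddV] 1(2) by simp
    moreover have "\<delta> / 2 \<le> infdist (x t j) \<Gamma>1"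
      if "(t, j) \<in> jump_domain T" "v + 1 \<le> t + real j" "t + real j \<le> t2 + real j2" for t j
    proof (rule ccontr)
      assume "\<not> \<delta> / 2 \<le> infdist (x t j) \<Gamma>1"
      then have "t + real j \<in> V" unfolding V_def using that by force
      then show False using cSup_upper[OF _ bddV] v(2) that(2) by force
    qed
    ultimately have "Q n (t3, j3) (t2, j2)"
      unfolding Q_def using 2 3 v(2) by (simp del: mem_jump_domain)
    then show ?thesis by blast
  qed
  then obtain p q where Q: "\<And>n. Q n (p n) (q n)" by metis
  define \<tau> k where "\<tau> i = fst (p i)" and "k i = snd (p i)" for i
  define t2 j2 where "t2 i = fst (q i)" and "j2 i = snd (q i)" for i
  have pk: "(\<tau> i, k i) \<in> jump_domain T" "real i - 1 \<le> \<tau> i + real (k i)"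
    and qk: "(t2 i, j2 i) \<in> jump_domain T" "\<tau> i + real (k i) \<le> t2 i + real (j2 i)"
    and near_p: "infdist (x (\<tau> i) (k i)) \<Gamma>1 < \<delta> / 2" and far_q: "e \<le> infdist (x (t2 i) (j2 i)) \<Gamma>1"
    and between: "\<And>t j. (t, j) \<in> jump_domain T \<Longrightarrow> \<tau> i + real (k i) + 1 \<le> t + real j \<Longrightarrow> t + real j \<le> t2 i + real (j2 i) \<Longrightarrow>
         \<delta> / 2 \<le> infdist (x t j) \<Gamma>1" for i
    using Q[of i] unfolding Q_def \<tau>_def k_def t2_def j2_def prod.collapse by blast+
  have ord: "\<tau> i \<le> t2 i" "k i \<le> j2 i" for i
    using jump_domain_chain[OF T pk(1) qk(1) qk(2)] by blast+
  obtain r T' y where r: "strict_mono r" and T': "jump_times T'"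
    and y: "maximal_solution (restriction H \<Gamma>2) (jump_domain T', y)"
    and CC: "\<forall>u a m c. strict_mono u \<and> (\<forall>\<^sub>F i in sequentially. 0 \<le> a i \<and> (\<tau> (r (u i)) + a i, k (r (u i)) + m) \<in> jump_domain T) \<and>
      a \<longlonglongrightarrow> c \<longrightarrow>
      (c, m) \<in> jump_domain T' \<and> (\<lambda>i. x (\<tau> (r (u i)) + a i) (k (r (u i)) + m)) \<longlonglongrightarrow> y c m"
    and AP: "\<forall>c m. (c, m) \<in> jump_domain T' \<longrightarrow>
      (\<exists>a. a \<longlonglongrightarrow> c \<and> (\<forall>\<^sub>F i in sequentially. 0 \<le> a i \<and> (\<tau> (r i) + a i, k (r i) + m) \<in> jump_domain T) \<and>
        (\<lambda>i. x (\<tau> (r i) + a i) (k (r i) + m)) \<longlonglongrightarrow> y c m)"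
    by (rule shifted_arcs_limit[OF H reg B cl ne2 conv pk])
  have y_close: "infdist (y c m) \<Gamma>1 < e" if "(c, m) \<in> jump_domain T'" for c m
  proof -
    have "(\<lambda>i. x (\<tau> (r i)) (k (r i))) \<longlonglongrightarrow> y 0 0"
      using CC[rule_format, of id "\<lambda>_. 0" 0 0] pk(1) strict_mono_id[where 'a=nat] by simp
    then have "infdist (y 0 0) \<Gamma>1 \<le> \<delta> / 2"
      by (rule LIMSEQ_le_const2[OF tendsto_infdist]) (use near_p less_imp_le in blast)
    then have "(jump_domain T', y) \<in> solutions_from (restriction H \<Gamma>2) (nbhd \<delta> \<Gamma>1)"
      using y \<delta>(1) by (simp add: solutions_from_def nbhd_def)
    then have "y c m \<in> nbhd e \<Gamma>1" using \<delta>(2) rng[OF that, of y] unfolding reach_def by blast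
    then show ?thesis by (simp add: nbhd_def)
  qed
  \<comment> \<open>Hybrid time 2 in the limit leaves at least 1 for the approximating points once
    \<open>a i > c - 1\<close>. Being close to \<Gamma>1 that late, they must come after the end of
    the excursion, which bounds its length by \<open>c + 1 + real m\<close>.\<close>
  obtain c m where cm: "(c, m) \<in> jump_domain T'" "2 \<le> c + real m" "infdist (y c m) \<Gamma>1 < \<delta> / 2"
    using attr[OF T' y] by blast
  obtain a where a: "a \<longlonglongrightarrow> c"
      "\<forall>\<^sub>F i in sequentially. 0 \<le> a i \<and> (\<tau> (r i) + a i, k (r i) + m) \<in> jump_domain T"
      "(\<lambda>i. x (\<tau> (r i) + a i) (k (r i) + m)) \<longlonglongrightarrow> y c m"
    using AP cm(1) by blast
  define \<alpha> \<mu> where "\<alpha> i = t2 (r i) - \<tau> (r i)" and "\<mu> i = j2 (r i) - k (r i)" for i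
  have \<alpha>\<mu>: "0 \<le> \<alpha> i" "\<tau> (r i) + \<alpha> i = t2 (r i)" "k (r i) + \<mu> i = j2 (r i)" for i
    using ord[of "r i"] by (auto simp: \<alpha>_def \<mu>_def)
  have "\<forall>\<^sub>F i in sequentially. c - 1 < a i" "\<forall>\<^sub>F i in sequentially. a i < c + 1"
    using order_tendstoD(1)[OF a(1), of "c - 1"] order_tendstoD(2)[OF a(1), of "c + 1"] by simp_all
  then have "\<forall>\<^sub>F i in sequentially. \<alpha> i + real (\<mu> i) \<le> c + 1 + real m"
    using a(2) order_tendstoD(2)[OF tendsto_infdist[OF a(3)] cm(3)]
  proof eventually_elim
    case (elim i)
    have "\<not> (\<tau> (r i) + a i) + real (k (r i) + m) \<le> t2 (r i) + real (j2 (r i))"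
      using between[of "\<tau> (r i) + a i" "k (r i) + m" "r i"] elim cm(2) by auto
    then show ?case using elim \<alpha>\<mu>(2)[of i] unfolding \<alpha>\<mu>(3)[of i, symmetric] by simp
  qed
  then obtain n0 where n0: "\<And>i. i \<ge> n0 \<Longrightarrow> \<alpha> i + real (\<mu> i) \<le> c + 1 + real m"
    unfolding eventually_sequentially by blast
  define w where "w i = (\<alpha> (i + n0), real (\<mu> (i + n0)))" for i
  have "range w \<subseteq> {0..c + 1 + real m} \<times> {0..c + 1 + real m}"
  proof -
    have "\<alpha> (i + n0) \<le> c + 1 + real m" "real (\<mu> (i + n0)) \<le> c + 1 + real m" for i
      using n0[of "i + n0"] \<alpha>\<mu>(1)[of "i + n0"] by auto
    then show ?thesis using \<alpha>\<mu>(1) by (auto simp: w_def)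
  qed
  then have "bounded (range w)"
    by (rule bounded_subset[rotated]) (intro bounded_Times bounded_closed_interval)
  then obtain l v where v: "strict_mono (v :: nat \<Rightarrow> nat)" "(w \<circ> v) \<longlonglongrightarrow> l"
    using bounded_imp_convergent_subsequence by blast
  define u where "u i = v i + n0" for i
  have u: "strict_mono u" using v(1) by (auto simp: u_def strict_mono_def)
  have \<alpha>l: "(\<lambda>i. \<alpha> (u i)) \<longlonglongrightarrow> fst l" and \<mu>l: "(\<lambda>i. real (\<mu> (u i))) \<longlonglongrightarrow> snd l"
    using tendsto_fst[OF v(2)] tendsto_snd[OF v(2)] by (simp_all add: w_def u_def o_def)
  \<comment> \<open>Two natural numbers at distance below 1 / 2 from the same limit coincide, so the
    number of jumps in the excursions is eventually constant.\<close>
  obtain n1 where n1: "\<And>i. i \<ge> n1 \<Longrightarrow> \<bar>real (\<mu> (u i)) - snd l\<bar> < 1 / 2"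
    using LIMSEQ_D[OF \<mu>l, of "1 / 2"] by auto
  define m' where "m' = \<mu> (u n1)"
  have \<mu>m: "\<mu> (u i) = m'" if "i \<ge> n1" for i
    using n1[OF that] n1[of n1] unfolding m'_def by linarith
  have ev: "\<forall>\<^sub>F i in sequentially. 0 \<le> \<alpha> (u i) \<and> (\<tau> (r (u i)) + \<alpha> (u i), k (r (u i)) + m') \<in> jump_domain T"
    using eventually_ge_at_top[of n1]
  proof eventually_elim
    case (elim i)
    show ?case using \<alpha>\<mu>[of "u i"] qk(1)[of "r (u i)"] \<mu>m[OF elim] by metis
  qed
  then have lim: "(fst l, m') \<in> jump_domain T'"
      "(\<lambda>i. x (\<tau> (r (u i)) + \<alpha> (u i)) (k (r (u i)) + m')) \<longlonglongrightarrow> y (fst l) m'"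
    using CC[rule_format, of u "\<lambda>i. \<alpha> (u i)" m' "fst l"] u \<alpha>l by blast+
  have "\<forall>\<^sub>F i in sequentially. e \<le> infdist (x (\<tau> (r (u i)) + \<alpha> (u i)) (k (r (u i)) + m')) \<Gamma>1"
    using eventually_ge_at_top[of n1]
  proof eventually_elim
    case (elim i)
    show ?case using \<alpha>\<mu>[of "u i"] far_q[of "r (u i)"] \<mu>m[OF elim] by metis
  qed
  then have "e \<le> infdist (y (fst l) m') \<Gamma>1"
    by (rule tendsto_lowerbound[OF tendsto_infdist[OF lim(2)]]) simp
  then show False using y_close[OF lim(1)] by simp
qed

theorem mainTheorem2:
  fixes H :: "(real ^ 'n) hybrid_system"
    and \<Gamma>1 \<Gamma>2 :: "(real ^ 'n) set"
  assumes "basic_assumptions H"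
    and "\<Gamma>1 \<subseteq> \<Gamma>2" and "compact \<Gamma>1" and "closed \<Gamma>2"
    and "globally_asymptotically_stable (restriction H \<Gamma>2) \<Gamma>1"
    and "globally_attractive_closed H \<Gamma>2"
  shows "basin H \<Gamma>1 = bounded_solution_points H
    \<and> (\<Gamma>1 \<subseteq> interior (bounded_solution_points H) \<longrightarrow> attractive H \<Gamma>1)
    \<and> ((\<forall>\<phi>. maximal_solution H \<phi> \<longrightarrow> bounded_arc \<phi>) \<longrightarrow> globally_attractive H \<Gamma>1)"
proof -
  \<comment> \<open>Boundedness is part of the definition of the basin, and an incomplete solution
    satisfies its convergence clause vacuously; only bounded complete solutions need an
    argument.\<close>
  have conv: "converges_to \<phi> \<Gamma>1" if \<phi>: "maximal_solution H \<phi>" "bounded_arc \<phi>" "complete_arc \<phi>" for \<phi>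
  proof (cases "\<Gamma>1 = {}")
    \<comment> \<open>\<open>infdist\<close> to the empty set is 0 by convention, so convergence is
      trivial here.\<close>
    case True
    then show ?thesis by (cases \<phi>) (simp add: converges_to_iff infdist_def)
  next
    case False
    obtain E x where Ex: "\<phi> = (E, x)" by (cases \<phi>)
    have sol: "solution H (E, x)" using \<phi>(1) Ex by (simp add: maximal_solution_def)
    then have "hybrid_time_domain E" by (simp add: solution_def hybrid_arc_def)
    then obtain T where T: "jump_times T" "E = jump_domain T"
      by (rule complete_domain_is_jump_domain) (use \<phi>(3) Ex in blast)
    have "x 0 0 \<in> basin_closed H \<Gamma>2" using assms(6) by (simp add: globally_attractive_closed_def)
    moreover have "\<phi> \<in> solutions_from H {x 0 0}" using \<phi>(1) Ex by (simp add: solutions_from_def)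
    ultimately have "converges_to \<phi> \<Gamma>2" using \<phi>(3) unfolding basin_closed_def by blast
    then show ?thesis
      using bounded_solution_converges[OF assms(1,2) False assms(4,5) T(1)] sol \<phi>(2) unfolding Ex T(2) by blast
  qed
  have "maximal_solution H \<phi>" if "\<phi> \<in> solutions_from H {p}" for \<phi> p
    using that by (auto simp: solutions_from_def)
  then have eq: "basin H \<Gamma>1 = bounded_solution_points H"
    unfolding basin_def bounded_solution_points_def using conv by blast
  moreover have "bounded_solution_points H = UNIV" if "\<forall>\<phi>. maximal_solution H \<phi> \<longrightarrow> bounded_arc \<phi>"
    using that unfolding bounded_solution_points_def solutions_from_def by blast
  ultimately show ?thesis unfolding attractive_def globally_attractive_def by simp
qed

end
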